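(* For $\beta\in(0,1]$ each atomic $\beta$-subconformal probability measure $\nu$ on $\mathbb T$ can be written uniquely as a (possibly infinite) convex linear combination $\nu=\sum_n\lambda_n\nu_{\beta,n}$ with coefficients $$\lambda_n=n^\beta\sum_{d\in\mathbb N^\times}\mu(d)\frac{1}{\varphi_\beta(nd)}\nu(Z_{nd}^* )\qquad n\in\mathbb N^\times.$$ In particular, $\{\nu_{\beta,n}:n\in\mathbb N^\times\}$ are the extremal atomic $\beta$-subconformal probability measures.
   Context: $\mathbb N^\times$ is the set of positive integers, $\mu$ the Möbius function, $\varphi$ Euler's totient, and $\varphi_\beta(n)=n^\beta\prod_{p\mid n}(1-p^{-\beta})$ (product over primes dividing $n$). $Z_k^*\subset\mathbb T$ is the set of primitive $k^{\mathrm{th}}$ roots of unity. $\mathrm{ord}(z)$ is the order of $z$ in the group $\mathbb T$. A measure $\nu$ on $\mathbb T$ is $\beta$-subconformal if $\sum_{d\mid n}\mu(d)d^{-\beta}\int_{\mathbb T}f(z^d)\,d\nu(z)\ge0$ for all $f\in C(\mathbb T)_+$ and all $n\in\mathbb N^\times$. For $n\in\mathbb N^\times$ and $\beta\in(0,\infty)$, $\nu_{\beta,n}$ is the atomic probability measure on $\mathbb T$ with $\nu_{\beta,n}(\{z\})=n^{-\beta}\frac{\varphi_\beta(\mathrm{ord}(z))}{\varphi(\mathrm{ord}(z))}$ if $z^n=1$ and $\nu_{\beta,n}(\{z\})=0$ otherwise. *)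

theory Defs
  imports "HOL-Probability.Probability" "HOL-Number_Theory.Number_Theory"
    "HOL-Computational_Algebra.Squarefree"
begin

definition moebius_mu :: "nat \<Rightarrow> int" where
  "moebius_mu n = (if squarefree n then (-1) ^ card (prime_factors n) else 0)"

text \<open>\<open>totient_powr 1\<close> is Euler's totient function.\<close>
definition totient_powr :: "real \<Rightarrow> nat \<Rightarrow> real" where
  "totient_powr \<beta> n = real n powr \<beta> * (\<Prod>p\<in>prime_factors n. 1 - real p powr (- \<beta>))"

abbreviation unit_circle :: "complex set" where
  "unit_circle \<equiv> sphere 0 1"

text \<open>The order in the multiplicative group of the circle; it is \<open>0\<close> for elements of infinite order.\<close>
definition unit_ord :: "complex \<Rightarrow> nat" where
  "unit_ord z = (if \<exists>k>0. z ^ k = 1 then LEAST k. k > 0 \<and> z ^ k = 1 else 0)"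

definition primitive_roots :: "nat \<Rightarrow> complex set" where
  "primitive_roots k = {z. k > 0 \<and> z ^ k = 1 \<and> (\<forall>j. 0 < j \<and> j < k \<longrightarrow> z ^ j \<noteq> 1)}"

definition circle_borel :: "complex measure" where
  "circle_borel = restrict_space borel unit_circle"

definition circle_prob :: "complex measure \<Rightarrow> bool" where
  "circle_prob \<nu> \<longleftrightarrow> prob_space \<nu> \<and> sets \<nu> = sets circle_borel"

text \<open>A measure is atomic if it is carried by a countable set, that is, if it is a countable
  combination of point masses.\<close>
definition atomic_measure :: "'a measure \<Rightarrow> bool" where
  "atomic_measure \<nu> \<longleftrightarrow> (\<exists>S. countable S \<and> (AE z in \<nu>. z \<in> S))"

definition subconformal :: "real \<Rightarrow> complex measure \<Rightarrow> bool" where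
  "subconformal \<beta> \<nu> \<longleftrightarrow>
     (\<forall>f :: complex \<Rightarrow> real. \<forall>n>0.
        continuous_on unit_circle f \<and> (\<forall>z\<in>unit_circle. f z \<ge> 0) \<longrightarrow>
        (\<Sum>d | d dvd n. of_int (moebius_mu d) * real d powr (- \<beta>) * (\<integral>z. f (z ^ d) \<partial>\<nu>)) \<ge> 0)"

definition atomic_subconformal_probs :: "real \<Rightarrow> complex measure set" where
  "atomic_subconformal_probs \<beta> = {\<nu>. circle_prob \<nu> \<and> atomic_measure \<nu> \<and> subconformal \<beta> \<nu>}"

text \<open>The measure \<open>\<nu>\<^bsub>\<beta>,n\<^esub>\<close>: weighted point masses on the \<open>n\<close>-th roots of unity, transported
  to the Borel sigma-algebra of the circle.\<close>
definition nu_measure :: "real \<Rightarrow> nat \<Rightarrow> complex measure" where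
  "nu_measure \<beta> n =
     distr (point_measure {z. z ^ n = 1}
              (\<lambda>z. ennreal (real n powr (- \<beta>) * (totient_powr \<beta> (unit_ord z) / real (totient (unit_ord z))))))
           circle_borel (\<lambda>z. z)"

lemma space_circle_borel [simp]: "space circle_borel = unit_circle"
  by (simp add: circle_borel_def space_restrict_space)

lemma roots_subset_unit_circle: "n > 0 \<Longrightarrow> {z::complex. z ^ n = 1} \<subseteq> unit_circle"
  by (auto dest: power_eq_1_iff)

text \<open>The point masses of \<open>nu_measure \<beta> n\<close> are the prescribed ones.\<close>
lemma emeasure_nu_measure_singleton:
  assumes "n > 0" "z \<in> unit_circle"
  shows "emeasure (nu_measure \<beta> n) {z} =
    (if z ^ n = 1
     then ennreal (real n powr (- \<beta>) * (totient_powr \<beta> (unit_ord z) / real (totient (unit_ord z))))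
     else 0)"
proof -
  have "{z} \<in> sets circle_borel"
    using assms(2) by (auto simp: circle_borel_def sets_restrict_space)
  moreover have "(\<lambda>z. z) \<in> point_measure {z. z ^ n = 1} w \<rightarrow>\<^sub>M circle_borel" for w :: "complex \<Rightarrow> ennreal"
    using roots_subset_unit_circle[OF assms(1)]
    by (auto simp: measurable_point_measure_eq1)
  moreover have "{z} \<inter> {z. z ^ n = 1} = (if z ^ n = 1 then {z} else {})"
    by auto
  ultimately show ?thesis
    by (simp add: nu_measure_def emeasure_distr space_point_measure emeasure_point_measure_finite2)
qed

text \<open>\<open>\<nu> = (\<Sum>n. c n * m n)\<close>, summed over the positive integers and understood setwise, with
  non-negative coefficients of total mass one. The value \<open>c 0\<close> is irrelevant.\<close>
definition is_convex_series ::
    "'a measure \<Rightarrow> (nat \<Rightarrow> 'a measure) \<Rightarrow> (nat \<Rightarrow> real) \<Rightarrow> bool" where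
  "is_convex_series \<nu> m c \<longleftrightarrow>
     (\<forall>n>0. c n \<ge> 0) \<and> (c has_sum 1) {0<..} \<and>
     (\<forall>A\<in>sets \<nu>. ((\<lambda>n. c n * measure (m n) A) has_sum measure \<nu> A) {0<..})"

text \<open>Extreme points of a set of measures. The library notion \<open>extreme_point_of\<close> needs a real vector
  space, which the type of measures is not.\<close>
definition extremal_measures :: "'a measure set \<Rightarrow> 'a measure set" where
  "extremal_measures K = {\<nu> \<in> K. \<forall>\<nu>1\<in>K. \<forall>\<nu>2\<in>K. \<forall>t. 0 < t \<and> t < 1 \<and>
      (\<forall>A\<in>sets \<nu>. measure \<nu> A = t * measure \<nu>1 A + (1 - t) * measure \<nu>2 A)
      \<longrightarrow> \<nu>1 = \<nu> \<and> \<nu>2 = \<nu>}"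

end

theory Submission
  imports Defs
begin

text \<open>For a finite set of primes with product \<open>n\<close>, subconformality says that
\<open>\<Prod>p dvd n. (1 - p powr (- \<beta>) * P p)\<close> maps \<open>\<nu>\<close> to a positive measure, where
\<open>P p\<close> is push-forward along \<open>z \<mapsto> z ^ p\<close>. This product form drives everything: sums
\<open>\<Sum>d dvd n. \<mu> d * h d\<close> are handled by adding one prime at a time
(\<open>moebius_sum_prime_times\<close>).

\<^bold>\<open>The measure lives on roots of unity.\<close> Writing \<open>1 - p powr (- s) * P p\<close> as
\<open>(1 - p powr (- \<beta>) * P p) + (p powr (- \<beta>) - p powr (- s)) * P p\<close> shows that
\<open>\<beta>\<close>-subconformality implies \<open>s\<close>-subconformality for all \<open>s \<ge> \<beta>\<close>
(\<open>subconformal_mono\<close>). As \<open>\<beta> \<le> 1\<close>, this includes \<open>s = 1\<close> and all \<open>s > 1\<close>. For \<open>s = 1\<close> it gives \<open>\<nu> {z ^ m} \<ge> \<nu> {z} / m\<close>; if \<open>z\<close> has infinite order,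
the points \<open>z ^ m\<close> are distinct and divergence of the harmonic series forces \<open>\<nu> {z} = 0\<close>.

\<^bold>\<open>The measure is uniform on primitive roots of each order\<close> (\<open>subconformal_atom_le\<close>). For \<open>s > 1\<close> the
full Moebius series \<open>a = \<Sum>d. \<mu> d * d powr (- s) * P d \<nu>\<close> converges, is positive, and inverts to
\<open>\<nu> = \<Sum>m. m powr (- s) * P m a\<close>. The mass of \<open>u\<close> is therefore an integral against \<open>a\<close> of
\<open>z \<mapsto> \<Sum>{m powr (- s) | z ^ m = u}\<close>. For two primitive \<open>k\<close>-th roots \<open>u\<close> and \<open>u'\<close> the exponents
run through arithmetic progressions with the same difference, and comparing the two sums termwise
bounds their ratio by \<open>1 + k powr s / \<zeta> s\<close>, uniformly in \<open>z\<close>. As \<open>s\<close> decreases to \<open>1\<close>, \<open>\<zeta> s\<close>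
tends to infinity and the masses of \<open>u\<close> and \<open>u'\<close> agree.

\<^bold>\<open>The expansion.\<close> Let \<open>x k\<close> be the mass of the primitive \<open>k\<close>-th roots divided by
\<open>totient_powr \<beta> k\<close>. Testing subconformality on that set of roots gives, up to a positive factor,
\<open>\<Sum>d dvd n. \<mu> d * x (k * d) \<ge> 0\<close>; hence \<open>y k = \<Sum>d. \<mu> d * x (k * d)\<close> is non-negative. Moebius inversion
\<open>x k = \<Sum>j. y (k * j)\<close> is legitimate since \<open>2 ^ \<omega> m\<close>, a bound for
\<open>\<Sum>d dvd m. \<bar>\<mu> d\<bar>\<close>, is dominated by \<open>totient_powr \<beta> m\<close>, so that
\<open>\<Sum>m. 2 ^ \<omega> m * x m\<close> converges. As \<open>nu_measure \<beta> n\<close> gives the primitive \<open>k\<close>-th roots the mass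
\<open>n powr (- \<beta>) * totient_powr \<beta> k\<close> for \<open>k dvd n\<close> and none otherwise, the identity for \<open>x\<close> is the
expansion with coefficients \<open>n powr \<beta> * y n\<close>. Applied to the coefficients of an arbitrary expansion,
the same inversion recovers them (\<open>convex_series_coefficient\<close>), which is uniqueness.

\<^bold>\<open>Extremality.\<close> The map \<open>z \<mapsto> z ^ d\<close> sends \<open>nu_measure \<beta> n\<close> to
\<open>nu_measure \<beta> (n div gcd n d)\<close>, from which each \<open>nu_measure \<beta> n\<close> is subconformal; so are all
countable mixtures. Uniqueness makes each \<open>nu_measure \<beta> n\<close> extremal. Conversely, splitting off one
term with positive coefficient leaves, after rescaling, a mixture of the remaining ones, so
an extremal measure equals that term.\<close>

section \<open>Moebius sums over divisors\<close>

definition moebius_sum :: "nat \<Rightarrow> (nat \<Rightarrow> real) \<Rightarrow> real" where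
  "moebius_sum n h = (\<Sum>d | d dvd n. of_int (moebius_mu d) * h d)"

lemma prime_factors_prime_times:
  fixes p n :: nat
  assumes "prime p" "n > 0"
  shows "prime_factors (p * n) = insert p (prime_factors n)"
  using assms by (simp add: prime_factors_product prime_prime_factors)

lemma moebius_mu_1 [simp]: "moebius_mu 1 = 1" "moebius_mu (Suc 0) = 1"
  by (simp_all add: moebius_mu_def)

lemma moebius_mu_prime_times:
  assumes p: "prime p" and "d > 0"
  shows "moebius_mu (p * d) = (if p dvd d then 0 else - moebius_mu d)"
proof (cases "p dvd d")
  case True
  then have "p\<^sup>2 dvd p * d" by (simp add: power2_eq_square)
  then have "\<not> squarefree (p * d)"
    using p unfolding squarefree_def by (metis not_prime_unit)
  then show ?thesis using True by (simp add: moebius_mu_def)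
next
  case False
  then have "coprime p d" using p prime_imp_coprime by blast
  then have sq: "squarefree (p * d) \<longleftrightarrow> squarefree d"
    using p squarefree_prime squarefree_mult_coprime squarefree_multD by blast
  have "prime_factors (p * d) = insert p (prime_factors d)"
    using p \<open>d > 0\<close> by (rule prime_factors_prime_times)
  moreover have "p \<notin> prime_factors d" using False by auto
  ultimately show ?thesis using sq False by (auto simp: moebius_mu_def)
qed

lemma moebius_mu_abs_le: "\<bar>real_of_int (moebius_mu n)\<bar> \<le> 1"
  by (simp add: moebius_mu_def power_abs)

lemma moebius_sum_1 [simp]: "moebius_sum 1 h = h 1" "moebius_sum (Suc 0) h = h (Suc 0)"
  by (simp_all add: moebius_sum_def)

lemma divisors_prime_times:
  fixes n :: nat
  assumes p: "prime p"
  shows "{d. d dvd p * n} = {d. d dvd n} \<union> (*) p ` {d. d dvd n}"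
proof (safe)
  fix d assume "d dvd p * n" "d \<notin> (*) p ` {d. d dvd n}"
  moreover have "p dvd d \<Longrightarrow> d \<in> (*) p ` {d. d dvd n}"
    using \<open>d dvd p * n\<close> p by (auto elim!: dvdE[of p])
  ultimately have "coprime p d" using p prime_imp_coprime by blast
  then show "d dvd n" using \<open>d dvd p * n\<close> coprime_dvd_mult_right_iff coprime_commute by blast
qed auto

text \<open>The product form of Moebius summation: adjoining a new prime \<open>p\<close> applies the operator
\<open>h \<mapsto> h - (\<lambda>d. h (p * d))\<close>, whereas a repeated prime has no effect because \<open>\<mu>\<close> vanishes on
non-squarefree numbers.\<close>
lemma moebius_sum_prime_times:
  assumes p: "prime p" and n: "n > 0"
  shows "moebius_sum (p * n) h =
    (if p dvd n then moebius_sum n h else moebius_sum n h - moebius_sum n (\<lambda>d. h (p * d)))"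
proof -
  have fin: "finite {d. d dvd n}" using n by simp
  have pos: "p > 0" using p prime_gt_0_nat by blast
  define f where "f d = of_int (moebius_mu d) * h d" for d
  have "moebius_sum (p * n) h = sum f ({d. d dvd n} \<union> (*) p ` {d. d dvd n})"
    by (simp add: moebius_sum_def divisors_prime_times[OF p] f_def)
  also have "\<dots> = sum f {d. d dvd n} + sum f ((*) p ` {d. d dvd n} - {d. d dvd n})"
    using fin by (subst Un_Diff_cancel[symmetric], intro sum.union_disjoint) auto
  finally have *: "moebius_sum (p * n) h = moebius_sum n h + sum f ((*) p ` {d. d dvd n} - {d. d dvd n})"
    by (simp add: moebius_sum_def f_def)
  show ?thesis
  proof (cases "p dvd n")
    case True
    have "f x = 0" if "x \<in> (*) p ` {d. d dvd n} - {d. d dvd n}" for x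
    proof -
      from that obtain d where d: "x = p * d" "d dvd n" "\<not> x dvd n" by auto
      \<comment> \<open>The new divisors are not squarefree: if p did not divide d, then p * d would already divide n.\<close>
      have "p dvd d"
      proof (rule ccontr)
        assume "\<not> p dvd d"
        then have "coprime p d" using p prime_imp_coprime by blast
        then show False using d True divides_mult by blast
      qed
      moreover have "d > 0" using d n by (auto intro!: Nat.gr0I)
      ultimately show ?thesis using moebius_mu_prime_times[OF p] d by (simp add: f_def)
    qed
    then show ?thesis using * True by simp
  next
    case False
    then have "(*) p ` {d. d dvd n} - {d. d dvd n} = (*) p ` {d. d dvd n}"
      by (auto dest: dvd_mult_left)
    moreover have "inj_on ((*) p) {d. d dvd n}" using pos by (auto intro: inj_onI)
    ultimately have "sum f ((*) p ` {d. d dvd n} - {d. d dvd n}) = (\<Sum>d | d dvd n. f (p * d))"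
      by (simp add: sum.reindex)
    also have "\<dots> = (\<Sum>d | d dvd n. - (of_int (moebius_mu d) * h (p * d)))"
    proof (rule sum.cong)
      fix d assume "d \<in> {d. d dvd n}"
      then have "d > 0" "\<not> p dvd d" using n False by (auto intro!: Nat.gr0I dest: dvd_trans)
      then show "f (p * d) = - (of_int (moebius_mu d) * h (p * d))"
        using moebius_mu_prime_times[OF p] by (simp add: f_def)
    qed simp
    also have "\<dots> = - moebius_sum n (\<lambda>d. h (p * d))"
      by (simp add: moebius_sum_def sum_negf)
    finally show ?thesis using * False by simp
  qed
qed

lemma nat_prime_times_induct [consumes 1, case_names one prime_times]:
  fixes n :: nat
  assumes "n > 0" "P 1" "\<And>p n. prime p \<Longrightarrow> n > 0 \<Longrightarrow> P n \<Longrightarrow> P (p * n)"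
  shows "P n"
proof -
  have "n > 0 \<longrightarrow> P n"
    by (induction n rule: prime_divisors_induct) (use assms in auto)
  then show ?thesis using \<open>n > 0\<close> by simp
qed

lemma moebius_sum_const:
  assumes "n > 0"
  shows "moebius_sum n (\<lambda>d. c) = (if n = 1 then c else 0)"
  using assms
proof (induction n rule: nat_prime_times_induct)
  case (prime_times p n)
  moreover have "p * n \<noteq> 1" "p \<noteq> 1" using prime_times(1) by auto
  ultimately show ?case
    using moebius_sum_prime_times[OF prime_times(1,2), of "\<lambda>d. c"] by (cases "n = 1") auto
qed auto

lemma moebius_sum_mult_left: "moebius_sum n (\<lambda>d. c * h d) = c * moebius_sum n h"
  by (simp add: moebius_sum_def sum_distrib_left algebra_simps)

lemma moebius_sum_add: "moebius_sum n (\<lambda>d. h d + g d) = moebius_sum n h + moebius_sum n g"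
  by (simp add: moebius_sum_def sum.distrib algebra_simps)

lemma moebius_sum_diff: "moebius_sum n (\<lambda>d. h d - g d) = moebius_sum n h - moebius_sum n g"
  by (simp add: moebius_sum_def sum_subtractf algebra_simps)

lemma moebius_sum_cong: "(\<And>d. d dvd n \<Longrightarrow> h d = g d) \<Longrightarrow> moebius_sum n h = moebius_sum n g"
  by (auto simp: moebius_sum_def intro!: sum.cong)

text \<open>Only the values of \<open>h\<close> at squarefree numbers enter, so multiplicativity is required only when a
new prime is split off.\<close>
lemma moebius_sum_multiplicative:
  assumes n: "n > 0" and h1: "h 1 = 1"
    and mult: "\<And>p d. prime p \<Longrightarrow> d > 0 \<Longrightarrow> \<not> p dvd d \<Longrightarrow> h (p * d) = h p * h d"
  shows "moebius_sum n h = (\<Prod>p\<in>prime_factors n. 1 - h p)"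
  using n
proof (induction n rule: nat_prime_times_induct)
  case (prime_times p n)
  have pf: "prime_factors (p * n) = insert p (prime_factors n)"
    by (rule prime_factors_prime_times[OF prime_times(1,2)])
  show ?case
  proof (cases "p dvd n")
    case True
    then have "p \<in> prime_factors n" using prime_times by (simp add: prime_factors_dvd)
    then show ?thesis using True prime_times pf by (simp add: moebius_sum_prime_times insert_absorb)
  next
    case False
    have "moebius_sum n (\<lambda>d. h (p * d)) = moebius_sum n (\<lambda>d. h p * h d)"
      using False prime_times
      by (intro moebius_sum_cong mult) (auto intro!: Nat.gr0I dest: dvd_trans)
    then have "moebius_sum (p * n) h = (1 - h p) * moebius_sum n h"
      using False prime_times moebius_sum_prime_times[of p n h]
      by (simp only: moebius_sum_mult_left if_False) (simp add: algebra_simps)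
    moreover have "p \<notin> prime_factors n" using False by auto
    ultimately show ?thesis using prime_times(3) unfolding pf by simp
  qed
qed (use h1 in auto)

text \<open>Along the divisor sets of the factorials, which exhaust the positive integers, the finite
Moebius sums converge to the infinite one.\<close>
lemma infsum_moebius_nonneg:
  assumes pos: "\<And>n. n > 0 \<Longrightarrow> moebius_sum n h \<ge> 0"
    and sum: "(\<lambda>d. of_int (moebius_mu d) * h d) summable_on {0<..}"
  shows "(\<Sum>\<^sub>\<infinity>d\<in>{0<..}. of_int (moebius_mu d) * h d) \<ge> 0"
proof -
  define f where "f d = of_int (moebius_mu d) * h d" for d
  have lim: "(sum f \<longlongrightarrow> infsum f {0<..}) (finite_subsets_at_top {0<..})"
    using sum has_sum_infsum unfolding has_sum_def f_def by blast
  have "filterlim (\<lambda>N. {d::nat. d dvd fact N}) (finite_subsets_at_top {0<..}) sequentially"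
    unfolding filterlim_finite_subsets_at_top
  proof safe
    fix X :: "nat set" assume X: "finite X" "X \<subseteq> {0<..}"
    have "d dvd fact N" if "d \<in> X" "Max X \<le> N" for d N
      using that X Max_ge[OF X(1) that(1)] by (intro dvd_fact) (auto simp: Suc_le_eq simp del: Max_ge)
    then show "\<forall>\<^sub>F N in sequentially. finite {d::nat. d dvd fact N} \<and> X \<subseteq> {d. d dvd fact N} \<and> {d::nat. d dvd fact N} \<subseteq> {0<..}"
      unfolding eventually_sequentially by (intro exI[of _ "Max X"]) (auto intro!: Nat.gr0I finite_divisors_nat)
  qed
  from filterlim_compose[OF lim this]
  have "(\<lambda>N. sum f {d. d dvd fact N}) \<longlonglongrightarrow> infsum f {0<..}" .
  moreover have "sum f {d. d dvd fact N} \<ge> 0" for N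
    using pos[of "fact N"] by (simp add: moebius_sum_def f_def)
  ultimately show ?thesis
    unfolding f_def[symmetric] by (intro tendsto_lowerbound[of _ _ sequentially]) auto
qed

text \<open>Grouping the pairs by the product \<open>k = m * d\<close> leaves \<open>H k * (\<Sum>d dvd k. \<mu> d)\<close>, which is zero unless
\<open>k = 1\<close>. Stating the result on pairs lets both orders of summation be extracted from it.\<close>
lemma moebius_inversion_pairs:
  fixes H :: "nat \<Rightarrow> real"
  assumes "(\<lambda>(m, d). of_int (moebius_mu d) * H (m * d)) summable_on {0<..} \<times> {0<..}"
  shows "((\<lambda>(m, d). of_int (moebius_mu d) * H (m * d)) has_sum H 1) ({0<..} \<times> {0<..})"
proof -
  define f where "f = (\<lambda>(m, d). of_int (moebius_mu d) * H (m * d))"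
  define g where "g = (\<lambda>(k, d). of_int (moebius_mu d) * H k)"
  have re: "(f has_sum S) ({0<..} \<times> {0<..}) \<longleftrightarrow> (g has_sum S) (Sigma {0<..} (\<lambda>k. {d. d dvd k}))" for S
    by (rule has_sum_reindex_bij_witness[of _ "\<lambda>(k, d). (k div d, d)" "\<lambda>(m, d). (m * d, d)"])
       (auto simp: f_def g_def intro!: Nat.gr0I elim!: dvdE)
  from assms have f: "(f has_sum infsum f ({0<..} \<times> {0<..})) ({0<..} \<times> {0<..})"
    using has_sum_infsum unfolding f_def by blast
  then have 1: "((\<lambda>k. moebius_sum k (\<lambda>_. H k)) has_sum infsum f ({0<..} \<times> {0<..})) {0<..}"
    unfolding re by (rule has_sum_SigmaD) (auto simp: g_def moebius_sum_def intro!: has_sum_finite)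
  have 2: "((\<lambda>k. moebius_sum k (\<lambda>_. H k)) has_sum H 1) {0<..}"
  proof -
    have "((\<lambda>k. moebius_sum k (\<lambda>_. H k)) has_sum H 1) {1}"
      by (rule has_sum_finiteI) auto
    then show ?thesis
      by (rule has_sum_cong_neutral[THEN iffD1, rotated -1]) (auto simp: moebius_sum_const)
  qed
  show ?thesis using f has_sum_unique[OF 1 2] unfolding f_def by simp
qed

section \<open>The generalised totient\<close>

lemma totient_powr_1 [simp]: "totient_powr \<beta> 1 = 1" "totient_powr \<beta> (Suc 0) = 1"
  by (simp_all add: totient_powr_def)

lemma totient_powr_prime_times:
  assumes p: "prime p" and n: "n > 0"
  shows "totient_powr \<beta> (p * n) =
    (if p dvd n then real p powr \<beta> else real p powr \<beta> - 1) * totient_powr \<beta> n"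
proof -
  have p0: "real p > 0" using p prime_gt_0_nat by simp
  have "real p powr \<beta> * (1 - real p powr (- \<beta>)) = real p powr \<beta> - 1"
    using p0 by (simp add: algebra_simps flip: powr_add)
  moreover have "p dvd n \<longleftrightarrow> p \<in> prime_factors n" using p n by (simp add: prime_factors_dvd)
  ultimately show ?thesis using p0
    by (auto simp: totient_powr_def prime_factors_prime_times[OF p n] powr_mult insert_absorb)
qed

lemma totient_prime_times:
  assumes p: "prime p"
  shows "totient (p * n) = (if p dvd n then p else p - 1) * totient n"
proof (cases "p dvd n")
  case True
  then have "gcd p n = p" by (simp add: gcd_nat.absorb1)
  moreover have "totient p > 0" using p prime_gt_0_nat by simp
  ultimately show ?thesis using True by (simp add: totient_mult)
next
  case False
  then show ?thesis using p by (simp add: totient_mult_coprime prime_imp_coprime totient_prime)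
qed

lemma prime_powr_gt_1: "prime p \<Longrightarrow> \<beta> > 0 \<Longrightarrow> real p powr \<beta> > 1"
  using prime_gt_1_nat[of p] by simp

lemma totient_powr_pos:
  assumes "\<beta> > 0" "n > 0"
  shows "totient_powr \<beta> n > 0"
  using assms(2)
proof (induction n rule: nat_prime_times_induct)
  case (prime_times p n)
  then show ?case using prime_powr_gt_1[of p \<beta>] assms(1) by (simp add: totient_powr_prime_times)
qed simp

lemma totient_powr_le:
  assumes "\<beta> > 0" "n > 0"
  shows "totient_powr \<beta> n \<le> real n powr \<beta>"
proof -
  have "(\<Prod>p\<in>prime_factors n. 1 - real p powr (- \<beta>)) \<le> 1"
  proof (rule prod_le_1)
    fix p assume "p \<in> prime_factors n"
    then have "real p powr \<beta> > 1" using prime_powr_gt_1 assms by blast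
    then show "0 \<le> 1 - real p powr (- \<beta>) \<and> 1 - real p powr (- \<beta>) \<le> 1"
      by (simp add: powr_minus inverse_le_1_iff)
  qed
  then show ?thesis unfolding totient_powr_def by (intro mult_left_le) auto
qed

text \<open>The analogue of \<open>\<Sum>k dvd n. totient k = n\<close>; it says that \<open>nu_measure \<beta> n\<close> has total mass one.\<close>
lemma sum_totient_powr_divisors:
  assumes "n > 0"
  shows "(\<Sum>k | k dvd n. totient_powr \<beta> k) = real n powr \<beta>"
  using assms
proof (induction n rule: nat_prime_times_induct)
  case (prime_times p n)
  have p0: "p > 0" using prime_times prime_gt_0_nat by blast
  \<comment> \<open>The divisors of p * n are those prime to p, collected in A, and p times each divisor of n.\<close>
  define A where "A = {k. k dvd n \<and> \<not> p dvd k}"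
  have fin: "finite {k. k dvd n}" using prime_times by simp
  have "{d. d dvd p * n} = A \<union> (*) p ` {d. d dvd n}"
    unfolding divisors_prime_times[OF prime_times(1)] by (auto simp: A_def elim: dvdE intro: dvd_mult_right)
  moreover have "finite A" using fin by (auto simp: A_def intro: finite_subset)
  moreover have "inj_on ((*) p) {d. d dvd n}" using p0 by (auto intro: inj_onI)
  moreover have "A \<inter> (*) p ` {d. d dvd n} = {}" by (auto simp: A_def)
  ultimately have "(\<Sum>k | k dvd p * n. totient_powr \<beta> k) =
      sum (totient_powr \<beta>) A + (\<Sum>k | k dvd n. totient_powr \<beta> (p * k))"
    using fin by (simp add: sum.union_disjoint sum.reindex)
  also have "(\<Sum>k | k dvd n. totient_powr \<beta> (p * k)) =
      (\<Sum>k | k dvd n. real p powr \<beta> * totient_powr \<beta> k - (if p dvd k then 0 else totient_powr \<beta> k))"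
  proof (rule sum.cong)
    fix k assume "k \<in> {k. k dvd n}"
    then have "k > 0" using prime_times(2) by (auto intro!: Nat.gr0I)
    then show "totient_powr \<beta> (p * k) =
        real p powr \<beta> * totient_powr \<beta> k - (if p dvd k then 0 else totient_powr \<beta> k)"
      using totient_powr_prime_times[OF prime_times(1), of k \<beta>] by (simp add: left_diff_distrib)
  qed simp
  also have "\<dots> = real p powr \<beta> * (\<Sum>k | k dvd n. totient_powr \<beta> k) - (\<Sum>k | k dvd n. if p dvd k then 0 else totient_powr \<beta> k)"
    by (simp add: sum_subtractf sum_distrib_left)
  also have "(\<Sum>k | k dvd n. if p dvd k then 0 else totient_powr \<beta> k) = sum (totient_powr \<beta>) A"
    unfolding A_def using fin by (intro sum.mono_neutral_cong_right) auto
  finally show ?case using prime_times by (simp add: powr_mult)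
qed simp

text \<open>Each prime factor \<open>p\<close> contributes at least \<open>p powr \<beta> - 1\<close> to \<open>totient_powr \<beta> m\<close>, which exceeds \<open>2\<close> for
all but finitely many primes; the exceptional primes cost only a constant. This makes the
rearrangements in Moebius inversion absolutely convergent for every \<open>\<beta> > 0\<close>.\<close>
lemma two_power_omega_le_totient_powr:
  assumes \<beta>: "\<beta> > 0"
  obtains C where "C > 0" "\<And>m. m > 0 \<Longrightarrow> 2 ^ card (prime_factors m) \<le> C * totient_powr \<beta> m"
proof -
  \<comment> \<open>The loss at p relative to the factor 2; it equals 1 outside the finite set P.\<close>
  define c where "c p = min 1 ((real p powr \<beta> - 1) / 2)" for p :: nat
  define P where "P = {p. prime p \<and> real p powr \<beta> < 3}"
  have "p \<le> nat \<lceil>3 powr (1 / \<beta>)\<rceil>" if "p \<in> P" for p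
  proof -
    have "(real p powr \<beta>) powr (1 / \<beta>) \<le> 3 powr (1 / \<beta>)"
      using that \<beta> by (intro powr_mono2) (auto simp: P_def)
    then have "real p \<le> 3 powr (1 / \<beta>)" using \<beta> by (simp add: powr_powr)
    then show ?thesis by linarith
  qed
  then have P: "finite P" using finite_nat_set_iff_bounded_le by blast
  have c: "0 < c p" "c p \<le> 1" if "prime p" for p
    using prime_powr_gt_1[OF that \<beta>] by (auto simp: c_def)
  have c1: "c p = 1" if "prime p" "p \<notin> P" for p
    using that by (auto simp: c_def P_def)
  have lower: "2 ^ card (prime_factors m) * prod c (prime_factors m) \<le> totient_powr \<beta> m" if "m > 0" for m
    using that
  proof (induction m rule: nat_prime_times_induct)
    case (prime_times p m)
    have pos: "totient_powr \<beta> m > 0" using \<beta> prime_times totient_powr_pos by blast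
    show ?case
    proof (cases "p dvd m")
      case True
      then have "p \<in> prime_factors m" using prime_times by (simp add: prime_factors_dvd)
      then have "prime_factors (p * m) = prime_factors m"
        using prime_factors_prime_times[OF prime_times(1,2)] by (simp only: insert_absorb)
      moreover have "totient_powr \<beta> m \<le> totient_powr \<beta> (p * m)"
        using True prime_times pos prime_powr_gt_1[of p \<beta>] \<beta> by (simp add: totient_powr_prime_times)
      ultimately show ?thesis using prime_times by simp
    next
      case False
      then have "p \<notin> prime_factors m" by auto
      then have "2 ^ card (prime_factors (p * m)) * prod c (prime_factors (p * m)) =
          (2 * c p) * (2 ^ card (prime_factors m) * prod c (prime_factors m))"
        using prime_times by (simp add: prime_factors_prime_times)
      also have "\<dots> \<le> (real p powr \<beta> - 1) * totient_powr \<beta> m"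
      proof (rule mult_mono)
        show "2 * c p \<le> real p powr \<beta> - 1"
        proof -
          have "2 * min 1 (y / 2) \<le> y" for y :: real by (simp add: min_def)
          then show ?thesis unfolding c_def .
        qed
        show "0 \<le> 2 ^ card (prime_factors m) * prod c (prime_factors m)"
          by (intro mult_nonneg_nonneg prod_nonneg) (auto intro!: less_imp_le c)
      qed (use prime_times prime_powr_gt_1[of p \<beta>] \<beta> in auto)
      finally show ?thesis using False prime_times by (simp add: totient_powr_prime_times)
    qed
  qed simp
  have pos: "prod c P > 0" by (intro prod_pos) (auto simp: P_def c)
  have P_le: "prod c P \<le> prod c (prime_factors m)" for m
  proof -
    have "prod c (prime_factors m) = prod c (prime_factors m \<inter> P)"
      using c1 by (intro prod.mono_neutral_right) auto
    moreover have "prod c P = prod c (prime_factors m \<inter> P) * prod c (P - prime_factors m)"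
      using P by (subst prod.union_disjoint[symmetric]) (auto intro!: prod.cong)
    moreover have "prod c (P - prime_factors m) \<le> 1"
      by (intro prod_le_1) (auto simp: P_def intro: c less_imp_le[OF c(1)])
    moreover have "prod c (prime_factors m \<inter> P) \<ge> 0"
      by (intro prod_nonneg) (auto intro!: less_imp_le c)
    ultimately show ?thesis by (simp add: mult_left_le)
  qed
  show thesis
  proof (rule that[of "1 / prod c P"])
    fix m :: nat assume "m > 0"
    have "2 ^ card (prime_factors m) * prod c P \<le> 2 ^ card (prime_factors m) * prod c (prime_factors m)"
      using P_le by (intro mult_left_mono) auto
    also have "\<dots> \<le> totient_powr \<beta> m" using lower[OF \<open>m > 0\<close>] .
    finally show "2 ^ card (prime_factors m) \<le> 1 / prod c P * totient_powr \<beta> m"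
      using pos by (simp add: field_simps)
  qed (use pos in auto)
qed

text \<open>A squarefree divisor is determined by its set of prime factors.\<close>
lemma sum_abs_moebius_le:
  assumes "n > 0"
  shows "(\<Sum>d | d dvd n. \<bar>real_of_int (moebius_mu d)\<bar>) \<le> 2 ^ card (prime_factors n)"
proof -
  have fin: "finite {d. d dvd n}" using assms by simp
  have "(\<Sum>d | d dvd n. \<bar>real_of_int (moebius_mu d)\<bar>) = (\<Sum>d | d dvd n \<and> squarefree d. 1)"
    using fin by (intro sum.mono_neutral_cong_right) (auto simp: moebius_mu_def)
  also have "\<dots> = real (card {d. d dvd n \<and> squarefree d})" by simp
  also have "\<dots> \<le> real (card (Pow (prime_factors n)))"
  proof (intro of_nat_mono card_inj_on_le[of prime_factors])
    have "\<Prod>(prime_factors d) = d" if "d dvd n" "squarefree d" for d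
    proof -
      have d: "d > 0" using that assms by (auto intro!: Nat.gr0I)
      then have "multiplicity p d = 1" if "p \<in> prime_factors d" for p
        using squarefree_factorial_semiring'[of d] that \<open>squarefree d\<close> by auto
      then show ?thesis
        using prime_factorization_nat[OF d] by simp
    qed
    then show "inj_on prime_factors {d. d dvd n \<and> squarefree d}"
      by (intro inj_onI) (metis (mono_tags, lifting) mem_Collect_eq)
    show "prime_factors ` {d. d dvd n \<and> squarefree d} \<subseteq> Pow (prime_factors n)"
      using assms dvd_prime_factors[of n] by blast
  qed auto
  finally show ?thesis by (simp add: card_Pow)
qed

text \<open>Absolute convergence over pairs amounts to summability of \<open>G k * (\<Sum>d dvd k. \<bar>\<mu> d\<bar>)\<close>.\<close>
lemma moebius_inversion:
  fixes G :: "nat \<Rightarrow> real"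
  assumes nonneg: "\<And>m. m > 0 \<Longrightarrow> G m \<ge> 0"
    and sum: "(\<lambda>m. 2 ^ card (prime_factors m) * G m) summable_on {0<..}"
  shows "((\<lambda>(m, d). of_int (moebius_mu d) * G (m * d)) has_sum G 1) ({0<..} \<times> {0<..})"
proof (rule moebius_inversion_pairs)
  define f where "f = (\<lambda>(m, d). \<bar>of_int (moebius_mu d)\<bar> * G (m * d))"
  define g where "g = (\<lambda>(k, d). \<bar>of_int (moebius_mu d)\<bar> * G k)"
  have re: "f summable_on ({0<..} \<times> {0<..}) \<longleftrightarrow> g summable_on (Sigma {0<..} (\<lambda>k. {d. d dvd k}))"
    by (rule summable_on_reindex_bij_witness[of _ "\<lambda>(k, d). (k div d, d)" "\<lambda>(m, d). (m * d, d)"])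
       (auto simp: f_def g_def intro!: Nat.gr0I elim!: dvdE)
  have "g summable_on (Sigma {0<..} (\<lambda>k. {d. d dvd k}))"
  proof (rule summable_on_SigmaI)
    fix k :: nat assume "k \<in> {0<..}"
    then show "((\<lambda>d. g (k, d)) has_sum (\<Sum>d | d dvd k. \<bar>of_int (moebius_mu d)\<bar>) * G k) {d. d dvd k}"
      by (intro has_sum_finiteI) (auto simp: g_def sum_distrib_right)
  next
    show "(\<lambda>k. (\<Sum>d | d dvd k. \<bar>of_int (moebius_mu d)\<bar>) * G k) summable_on {0<..}"
      by (rule summable_on_comparison_test[OF sum])
         (use nonneg sum_abs_moebius_le in \<open>auto intro!: mult_right_mono mult_nonneg_nonneg sum_nonneg\<close>)
  qed (use nonneg in \<open>auto simp: g_def\<close>)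
  then have "f summable_on ({0<..} \<times> {0<..})" using re by simp
  then have "(\<lambda>x. norm ((\<lambda>(m, d). of_int (moebius_mu d) * G (m * d)) x)) summable_on {0<..} \<times> {0<..}"
    by (rule summable_on_cong[THEN iffD1, rotated]) (use nonneg in \<open>auto simp: f_def abs_mult\<close>)
  then show "(\<lambda>(m, d). of_int (moebius_mu d) * G (m * d)) summable_on {0<..} \<times> {0<..}"
    by (rule abs_summable_summable)
qed

section \<open>Orders of roots of unity\<close>

lemma unit_ord_pos_iff: "unit_ord z > 0 \<longleftrightarrow> (\<exists>k>0. z ^ k = 1)"
  unfolding unit_ord_def by (auto intro: LeastI2)

lemma power_unit_ord [simp]: "z ^ unit_ord z = 1"
proof (cases "\<exists>k>0. z ^ k = 1")
  case True
  then have "unit_ord z > 0 \<and> z ^ unit_ord z = 1"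
    unfolding unit_ord_def by (simp only: if_True) (rule LeastI_ex)
  then show ?thesis by blast
next
  case False
  then have "unit_ord z = 0" unfolding unit_ord_def by (simp only: if_False)
  then show ?thesis by simp
qed

lemma unit_ord_pos_nonzero: "unit_ord z > 0 \<Longrightarrow> z \<noteq> 0"
  using power_unit_ord[of z] by (metis zero_neq_one zero_power)

lemma unit_ord_le: "k > 0 \<Longrightarrow> z ^ k = 1 \<Longrightarrow> unit_ord z \<le> k"
  unfolding unit_ord_def by (auto intro: Least_le)

lemma power_eq_1_iff_unit_ord_dvd: "z ^ m = 1 \<longleftrightarrow> unit_ord z dvd m"
proof
  assume "unit_ord z dvd m"
  then show "z ^ m = 1" by (auto simp: power_mult elim!: dvdE)
next
  assume m: "z ^ m = 1"
  show "unit_ord z dvd m"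
  proof (cases "m = 0")
    case False
    then have pos: "unit_ord z > 0" using m by (auto simp: unit_ord_pos_iff)
    have "z ^ m = z ^ (unit_ord z * (m div unit_ord z) + m mod unit_ord z)" by simp
    also have "\<dots> = z ^ (m mod unit_ord z)" by (simp only: power_add power_mult) simp
    finally have "z ^ (m mod unit_ord z) = 1" using m by simp
    then have "m mod unit_ord z = 0"
      using unit_ord_le[of "m mod unit_ord z" z] mod_less_divisor[OF pos, of m] by linarith
    then show ?thesis by blast
  qed simp
qed

lemma unit_ord_eqI: "(\<And>m. z ^ m = 1 \<longleftrightarrow> k dvd m) \<Longrightarrow> unit_ord z = k"
  using power_eq_1_iff_unit_ord_dvd by (metis dvd_antisym dvd_refl)

lemma primitive_roots_iff: "z \<in> primitive_roots k \<longleftrightarrow> k > 0 \<and> unit_ord z = k"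
proof
  assume "z \<in> primitive_roots k"
  then have k: "k > 0" "z ^ k = 1" "\<forall>j. 0 < j \<and> j < k \<longrightarrow> z ^ j \<noteq> 1"
    by (auto simp: primitive_roots_def)
  then have "unit_ord z > 0" "unit_ord z \<le> k" by (auto simp: unit_ord_pos_iff unit_ord_le)
  then show "k > 0 \<and> unit_ord z = k" using k by (metis le_neq_implies_less power_unit_ord)
next
  assume "k > 0 \<and> unit_ord z = k"
  then show "z \<in> primitive_roots k"
    by (auto simp: primitive_roots_def power_eq_1_iff_unit_ord_dvd dest: dvd_imp_le)
qed

lemma unit_ord_power:
  assumes "unit_ord z > 0"
  shows "unit_ord (z ^ m) = unit_ord z div gcd (unit_ord z) m"
proof (rule unit_ord_eqI)
  fix j
  define l g where "l = unit_ord z" and "g = gcd l m"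
  have "g > 0" "l > 0" using assms by (auto simp: g_def l_def)
  then obtain l' m' where lm: "l = g * l'" "m = g * m'" "coprime l' m'"
    using gcd_coprime_exists[of l m] unfolding g_def by (auto simp: mult.commute)
  have "(z ^ m) ^ j = 1 \<longleftrightarrow> g * l' dvd g * (m' * j)"
    using lm by (simp add: power_eq_1_iff_unit_ord_dvd l_def mult.assoc flip: power_mult)
  also have "\<dots> \<longleftrightarrow> l' dvd j" using \<open>g > 0\<close> lm(3) by (simp add: coprime_dvd_mult_right_iff)
  also have "l' = l div g" using lm \<open>g > 0\<close> by simp
  finally show "(z ^ m) ^ j = 1 \<longleftrightarrow> unit_ord z div gcd (unit_ord z) m dvd j"
    by (simp add: l_def g_def)
qed

lemma unit_ord_power_coprime:
  "unit_ord z > 0 \<Longrightarrow> coprime (unit_ord z) m \<Longrightarrow> unit_ord (z ^ m) = unit_ord z"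
  by (simp add: unit_ord_power)

lemma primitive_roots_subset: "primitive_roots k \<subseteq> {z. z ^ k = 1}"
  by (auto simp: primitive_roots_def)

lemma finite_primitive_roots [simp]: "finite (primitive_roots k)"
proof (cases "k > 0")
  case True
  then show ?thesis using finite_subset[OF primitive_roots_subset] finite_roots_unity[of k] by simp
qed (simp add: primitive_roots_def)

lemma primitive_roots_subset_circle: "primitive_roots k \<subseteq> unit_circle"
  using roots_subset_unit_circle[of k] primitive_roots_subset[of k] by (auto simp: primitive_roots_def)

lemma inj_on_power_unit_ord:
  assumes "unit_ord v = k" "k > 0"
  shows "inj_on (\<lambda>j. v ^ j) {0<..k}"
proof -
  have v: "v \<noteq> 0" using assms unit_ord_pos_nonzero[of v] by simp
  have "j = i" if "v ^ i = v ^ j" "i \<le> j" "0 < i" "j \<le> k" for i j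
  proof -
    have "v ^ i * v ^ (j - i) = v ^ j" using that(2) by (simp flip: power_add)
    then have "v ^ (j - i) = 1" using v that(1) by simp
    then have "k dvd j - i" using assms power_eq_1_iff_unit_ord_dvd by blast
    moreover have "j - i < k" using that by linarith
    ultimately show ?thesis using that nat_dvd_not_less[of "j - i" k] by (cases "j = i") auto
  qed
  then show ?thesis by (intro inj_onI) (metis greaterThanAtMost_iff nat_le_linear)
qed

lemma roots_eq_powers:
  assumes "unit_ord v = k" "k > 0"
  shows "{z. z ^ k = 1} = (\<lambda>j. v ^ j) ` {0<..k}"
proof (rule sym, rule card_subset_eq)
  show "finite {z::complex. z ^ k = 1}" using assms finite_roots_unity[of k] by (simp add: Suc_le_eq)
  show "(\<lambda>j. v ^ j) ` {0<..k} \<subseteq> {z. z ^ k = 1}"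
  proof safe
    fix j
    have "(v ^ j) ^ k = (v ^ k) ^ j" by (simp add: mult.commute flip: power_mult)
    then show "(v ^ j) ^ k = 1" using assms power_unit_ord[of v] by simp
  qed
  show "card ((\<lambda>j. v ^ j) ` {0<..k}) = card {z::complex. z ^ k = 1}"
    using assms inj_on_power_unit_ord[OF assms] by (simp add: card_image card_roots_unity_eq)
qed

lemma bij_betw_totatives_primitive_roots:
  assumes "unit_ord v = k" "k > 0"
  shows "bij_betw (\<lambda>j. v ^ j) (totatives k) (primitive_roots k)"
proof -
  have "(\<lambda>j. v ^ j) ` totatives k = primitive_roots k"
  proof (intro equalityI subsetI)
    fix z assume "z \<in> (\<lambda>j. v ^ j) ` totatives k"
    then show "z \<in> primitive_roots k"
      using assms by (auto simp: primitive_roots_iff unit_ord_power_coprime totatives_def coprime_commute)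
  next
    fix z assume z: "z \<in> primitive_roots k"
    then obtain j where j: "z = v ^ j" "j \<in> {0<..k}"
      using primitive_roots_subset[of k] roots_eq_powers[OF assms] by blast
    have kj: "k div gcd k j = k" using z j assms unit_ord_power[of v j] by (simp add: primitive_roots_iff)
    have "gcd k j * (k div gcd k j) = k" by (rule dvd_mult_div_cancel) simp
    then have "gcd k j * k = 1 * k" unfolding kj by simp
    then have "gcd k j = 1" using \<open>k > 0\<close> by auto
    then have "coprime j k" by (metis coprime_iff_gcd_eq_1 gcd.commute)
    then show "z \<in> (\<lambda>j. v ^ j) ` totatives k" using j by (auto simp: totatives_def)
  qed
  moreover have "inj_on (\<lambda>j. v ^ j) (totatives k)"
    using inj_on_power_unit_ord[OF assms] by (rule inj_on_subset) (auto simp: totatives_def)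
  ultimately show ?thesis by (simp add: bij_betw_def)
qed

lemma ex_unit_ord:
  assumes "k > 0"
  obtains v where "unit_ord v = k"
proof -
  have "unit_ord (cis (2 * pi / k)) = k"
  proof (rule unit_ord_eqI)
    fix m
    have "cis (2 * pi / k) ^ m = cis (real m * (2 * pi / k))" by (rule Complex.DeMoivre)
    then have "cis (2 * pi / k) ^ m = 1 \<longleftrightarrow> (\<exists>n::int. real m * (2 * pi / k) = 2 * pi * of_int n)"
      by (simp add: cis_conv_exp exp_eq_1 mult_ac)
    also have "\<dots> \<longleftrightarrow> (\<exists>n::int. real m = real k * of_int n)"
      using assms by (simp add: field_simps)
    also have "\<dots> \<longleftrightarrow> (\<exists>n::int. int m = int k * n)"
    proof (intro ex_cong1)
      fix n :: int
      have "real m = real k * of_int n \<longleftrightarrow> real_of_int (int m) = real_of_int (int k * n)" by simp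
      then show "real m = real k * of_int n \<longleftrightarrow> int m = int k * n" by (simp only: of_int_eq_iff)
    qed
    also have "\<dots> \<longleftrightarrow> int k dvd int m" by (simp add: dvd_def)
    also have "\<dots> \<longleftrightarrow> k dvd m" by simp
    finally show "cis (2 * pi / k) ^ m = 1 \<longleftrightarrow> k dvd m" .
  qed
  then show ?thesis using that by blast
qed

lemma card_primitive_roots: "card (primitive_roots k) = totient k"
proof (cases "k > 0")
  case True
  then obtain v where "unit_ord v = k" using ex_unit_ord by blast
  then show ?thesis using bij_betw_same_card[OF bij_betw_totatives_primitive_roots] True
    by (metis totient_def)
qed (simp add: primitive_roots_def)

lemma roots_eq_Union_primitive: "n > 0 \<Longrightarrow> {z. z ^ n = 1} = (\<Union>k\<in>{k. k dvd n}. primitive_roots k)"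
  by (auto simp: primitive_roots_iff power_eq_1_iff_unit_ord_dvd intro!: Nat.gr0I)

lemma sum_roots_unity:
  assumes "n > 0"
  shows "(\<Sum>z | z ^ n = 1. F z) = (\<Sum>k | k dvd n. \<Sum>z\<in>primitive_roots k. F z)"
  unfolding roots_eq_Union_primitive[OF assms] using assms
  by (subst sum.UNION_disjoint) (auto simp: primitive_roots_iff)

lemma primitive_roots_transitive:
  assumes "u \<in> primitive_roots k" "u' \<in> primitive_roots k"
  obtains r where "u' = u ^ r" "coprime r k" "r > 0"
proof -
  have "u' \<in> (\<lambda>j. u ^ j) ` totatives k"
    using assms bij_betw_totatives_primitive_roots[of u k] by (auto simp: primitive_roots_iff bij_betw_def)
  then show ?thesis using that by (auto simp: totatives_def)
qed

text \<open>Taking the \<open>p\<close>-th power divides the order by \<open>p\<close> if possible and otherwise preserves it.\<close>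
lemma power_in_primitive_roots_iff:
  assumes p: "prime p"
  shows "z ^ p \<in> primitive_roots k \<longleftrightarrow>
    z \<in> primitive_roots (p * k) \<or> \<not> p dvd k \<and> z \<in> primitive_roots k"
proof (cases "unit_ord z > 0")
  case True
  have p0: "p > 1" using p prime_gt_1_nat by blast
  define l where "l = unit_ord z"
  have l: "l > 0" using True by (simp add: l_def)
  have o: "unit_ord (z ^ p) = l div gcd l p" using unit_ord_power[OF True] by (simp add: l_def)
  have *: "l div gcd l p = k \<longleftrightarrow> l = p * k \<or> \<not> p dvd k \<and> l = k" if k: "k > 0"
  proof (cases "p dvd l")
    case pl: True
    then obtain i where i: "l = p * i" by blast
    then have "l div gcd l p = i" using p0 by simp
    then show ?thesis using i p0 pl by auto
  next
    case False
    then have "gcd l p = 1" using p by (metis coprime_iff_gcd_eq_1 coprime_commute prime_imp_coprime)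
    then show ?thesis using False by auto
  qed
  show ?thesis using * l p0 by (auto simp: primitive_roots_iff o simp flip: l_def)
next
  case False
  have "unit_ord (z ^ p) = 0"
  proof (rule ccontr)
    assume "unit_ord (z ^ p) \<noteq> 0"
    then have "z ^ (p * unit_ord (z ^ p)) = 1" "p * unit_ord (z ^ p) > 0"
      using p prime_gt_0_nat by (auto simp: power_mult)
    then show False using False unfolding unit_ord_pos_iff by blast
  qed
  then show ?thesis using False p prime_gt_0_nat by (auto simp: primitive_roots_iff)
qed

text \<open>Up to the factor \<open>n powr (- \<beta>)\<close>, the point mass of \<open>nu_measure \<beta> n\<close> at an \<open>n\<close>-th root of unity. The weight
does not depend on \<open>n\<close>, which is what makes the family stable under \<open>z \<mapsto> z ^ p\<close>.\<close>
definition root_weight :: "real \<Rightarrow> complex \<Rightarrow> real" where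
  "root_weight \<beta> z = totient_powr \<beta> (unit_ord z) / real (totient (unit_ord z))"

lemma root_weight_pos: "\<beta> > 0 \<Longrightarrow> unit_ord z > 0 \<Longrightarrow> root_weight \<beta> z > 0"
  by (simp add: root_weight_def totient_powr_pos)

lemma sum_root_weight_primitive:
  "k > 0 \<Longrightarrow> (\<Sum>z\<in>primitive_roots k. root_weight \<beta> z) = totient_powr \<beta> k"
proof -
  assume "k > 0"
  have "(\<Sum>z\<in>primitive_roots k. root_weight \<beta> z) = (\<Sum>z\<in>primitive_roots k. totient_powr \<beta> k / real (totient k))"
    by (intro sum.cong) (auto simp: primitive_roots_iff root_weight_def)
  then show ?thesis using \<open>k > 0\<close> by (simp add: card_primitive_roots)
qed

lemma inj_on_coprime_power:
  assumes "n > 0" "coprime m n"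
  shows "inj_on (\<lambda>z::complex. z ^ m) {z. z ^ n = 1}"
proof (rule inj_onI)
  fix z w :: complex assume zw: "z \<in> {z. z ^ n = 1}" "w \<in> {z. z ^ n = 1}" "z ^ m = w ^ m"
  have "w \<noteq> 0" using zw(2) assms(1) by (auto simp: power_0_left)
  have "(z / w) ^ m = 1" "(z / w) ^ n = 1"
    using zw \<open>w \<noteq> 0\<close> by (auto simp: power_divide)
  then have "unit_ord (z / w) = 1"
    using assms(2) unfolding power_eq_1_iff_unit_ord_dvd by (metis coprime_common_divisor_nat)
  then have "(z / w) ^ 1 = 1" using power_unit_ord[of "z / w"] by simp
  then show "z = w" using \<open>w \<noteq> 0\<close> by simp
qed

text \<open>With \<open>k\<close> the order of \<open>u\<close>: if \<open>p dvd k\<close>, all \<open>p\<close> roots \<open>z\<close> of \<open>z ^ p = u\<close> have order \<open>p * k\<close>; otherwise exactly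
one has order \<open>k\<close> and the other \<open>p - 1\<close> have order \<open>p * k\<close>. In both cases the weights add up to
\<open>p powr \<beta>\<close> times the weight of \<open>u\<close>.\<close>
lemma sum_root_weight_prime_preimage:
  assumes p: "prime p" and u: "unit_ord u > 0"
  shows "(\<Sum>z | z ^ p = u. root_weight \<beta> z) = real p powr \<beta> * root_weight \<beta> u"
proof -
  have p1: "p > 1" using p prime_gt_1_nat by blast
  define k where "k = unit_ord u"
  have k: "k > 0" "u \<in> primitive_roots k" using u by (auto simp: k_def primitive_roots_iff)
  have u0: "u \<noteq> 0" using u by (rule unit_ord_pos_nonzero)
  have fin: "finite {z. z ^ p = u}" using p1 finite_nth_roots by simp
  have card: "card {z. z ^ p = u} = p" using p1 u0 by (intro card_nth_roots) auto
  have ord: "unit_ord z = p * k \<or> \<not> p dvd k \<and> unit_ord z = k" if "z ^ p = u" for z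
    using power_in_primitive_roots_iff[OF p, of z k] that k(2) by (auto simp: primitive_roots_iff)
  \<comment> \<open>The two possible orders of a p-th root of u.\<close>
  define A where "A = {z. z ^ p = u \<and> unit_ord z = p * k}"
  define B where "B = {z. z ^ p = u \<and> unit_ord z = k \<and> \<not> p dvd k}"
  have "p * k \<noteq> k" using p1 k(1) by simp
  then have AB2: "A \<inter> B = {}" by (auto simp: A_def B_def simp del: mult_eq_self_implies_10)
  have AB1: "{z. z ^ p = u} = A \<union> B"
  proof (intro equalityI subsetI)
    fix z assume "z \<in> {z. z ^ p = u}"
    then show "z \<in> A \<union> B"
      unfolding A_def B_def Un_iff mem_Collect_eq using ord[of z] by argo
  next
    fix z assume "z \<in> A \<union> B"
    then show "z \<in> {z. z ^ p = u}"
      unfolding A_def B_def Un_iff mem_Collect_eq by argo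
  qed
  note AB = AB1 AB2
  have finAB: "finite A" "finite B" using fin by (auto simp: A_def B_def)
  have cB: "card B = (if p dvd k then 0 else 1)"
  proof (cases "p dvd k")
    case False
    then have cop: "coprime p k" using p prime_imp_coprime by blast
    have inj: "inj_on (\<lambda>z. z ^ p) (primitive_roots k)"
      using inj_on_subset[OF inj_on_coprime_power[OF k(1) cop] primitive_roots_subset] .
    have "(\<lambda>z. z ^ p) ` primitive_roots k \<subseteq> primitive_roots k"
      using False by (auto simp: power_in_primitive_roots_iff[OF p])
    then have "(\<lambda>z. z ^ p) ` primitive_roots k = primitive_roots k"
      using inj by (intro endo_inj_surj) auto
    then have "u \<in> (\<lambda>z. z ^ p) ` primitive_roots k" using k(2) by simp
    then obtain z where z: "z \<in> primitive_roots k" "z ^ p = u" by (elim imageE) (rule that, simp_all)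
    have "w = z" if "w \<in> B" for w
    proof (rule inj_onD[OF inj])
      show "w ^ p = z ^ p" using that z(2) unfolding B_def by simp
      show "w \<in> primitive_roots k" using that k(1) unfolding B_def primitive_roots_iff by blast
    qed (rule z(1))
    moreover have "z \<in> B" using z False unfolding B_def primitive_roots_iff by blast
    ultimately have "B = {z}" by blast
    then show ?thesis using False by simp
  qed (simp add: B_def)
  have cA: "card A = (if p dvd k then p else p - 1)"
  proof -
    have "card A + card B = p"
      using card_Un_disjoint[OF finAB AB2] card unfolding AB1 by linarith
    then show ?thesis using cB by (cases "p dvd k") auto
  qed
  have "(\<Sum>z | z ^ p = u. root_weight \<beta> z) = (\<Sum>z\<in>A. root_weight \<beta> z) + (\<Sum>z\<in>B. root_weight \<beta> z)"
    using AB finAB by (simp add: sum.union_disjoint)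
  also have "(\<Sum>z\<in>A. root_weight \<beta> z) = real (card A) * (totient_powr \<beta> (p * k) / real (totient (p * k)))"
    by (simp add: A_def root_weight_def)
  also have "(\<Sum>z\<in>B. root_weight \<beta> z) = real (card B) * (totient_powr \<beta> k / real (totient k))"
    by (simp add: B_def root_weight_def)
  finally have sum: "(\<Sum>z | z ^ p = u. root_weight \<beta> z) =
      real (card A) * (totient_powr \<beta> (p * k) / real (totient (p * k))) +
      real (card B) * (totient_powr \<beta> k / real (totient k))" .
  have u: "root_weight \<beta> u = totient_powr \<beta> k / real (totient k)"
    by (simp add: root_weight_def k_def)
  note rec = totient_powr_prime_times[OF p k(1)] totient_prime_times[OF p, of k]
  show ?thesis
  proof (cases "p dvd k")
    case True
    then show ?thesis using p1 unfolding sum u cA cB rec by simp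
  next
    case False
    have "real (p - 1) * ((real p powr \<beta> - 1) * totient_powr \<beta> k / real ((p - 1) * totient k)) =
        (real p powr \<beta> - 1) * (totient_powr \<beta> k / real (totient k))"
      using p1 by simp
    then show ?thesis using False p1 unfolding sum u cA cB rec
      by (simp add: left_diff_distrib diff_divide_distrib)
  qed
qed

section \<open>Subconformality tested on points\<close>

definition power_preimage :: "nat \<Rightarrow> complex set \<Rightarrow> complex set" where
  "power_preimage d E = {z \<in> unit_circle. z ^ d \<in> E}"

lemma circle_probD:
  assumes "circle_prob \<nu>"
  shows "prob_space \<nu>" "sets \<nu> = sets circle_borel" "space \<nu> = unit_circle"
proof -
  show *: "prob_space \<nu>" "sets \<nu> = sets circle_borel" using assms by (auto simp: circle_prob_def)
  show "space \<nu> = unit_circle" using sets_eq_imp_space_eq[OF *(2)] by simp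
qed

lemma circle_borel_countable:
  assumes "countable E" "E \<subseteq> unit_circle"
  shows "E \<in> sets circle_borel"
proof -
  have "E \<in> sets borel" using assms(1) by (rule sets.countable[rotated]) auto
  then show ?thesis using assms(2) by (auto simp: circle_borel_def sets_restrict_space)
qed

lemma countable_in_sets_circle:
  assumes "circle_prob \<nu>" "countable E" "E \<subseteq> unit_circle"
  shows "E \<in> sets \<nu>"
  using circle_borel_countable[OF assms(2,3)] circle_probD(2)[OF assms(1)] by simp

lemma finite_power_preimage:
  assumes "finite E" "d > 0"
  shows "finite (power_preimage d E)"
proof -
  have "power_preimage d E \<subseteq> (\<Union>u\<in>E. {z. z ^ d = u})" by (auto simp: power_preimage_def)
  then show ?thesis using assms finite_nth_roots by (auto intro: finite_subset)
qed

lemma power_preimage_subset: "power_preimage d E \<subseteq> unit_circle"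
  by (auto simp: power_preimage_def)

lemma power_in_circle: "z \<in> unit_circle \<Longrightarrow> z ^ d \<in> unit_circle"
  by (simp add: norm_power)

lemma power_preimage_1 [simp]:
  "E \<subseteq> unit_circle \<Longrightarrow> power_preimage 1 E = E"
  "E \<subseteq> unit_circle \<Longrightarrow> power_preimage (Suc 0) E = E"
  by (auto simp: power_preimage_def)

lemma power_preimage_preimage: "power_preimage d (power_preimage m E) = power_preimage (d * m) E"
  using power_in_circle by (auto simp: power_preimage_def power_mult)

lemma measure_power_preimage_sum:
  assumes \<nu>: "circle_prob \<nu>" and E: "finite E" and d: "d > 0"
  shows "measure \<nu> (power_preimage d E) = (\<Sum>u\<in>E. measure \<nu> (power_preimage d {u}))"
proof -
  interpret prob_space \<nu> using circle_probD(1)[OF \<nu>] .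
  have "power_preimage d E = (\<Union>u\<in>E. power_preimage d {u})" by (auto simp: power_preimage_def)
  moreover have "(\<lambda>u. power_preimage d {u}) ` E \<subseteq> sets \<nu>"
    using countable_in_sets_circle[OF \<nu>] finite_power_preimage[OF _ d] power_preimage_subset
    by (auto simp: countable_finite)
  moreover have "disjoint_family_on (\<lambda>u. power_preimage d {u}) E"
    by (auto simp: disjoint_family_on_def power_preimage_def)
  ultimately show ?thesis using finite_measure_finite_Union[OF E] by simp
qed

lemma continuous_circle_measurable:
  assumes "circle_prob \<nu>" "continuous_on unit_circle f"
  shows "f \<in> borel_measurable \<nu>"
proof -
  have "f \<in> borel_measurable circle_borel"
    unfolding circle_borel_def using assms(2) by (rule borel_measurable_continuous_on_restrict)
  then show ?thesis using measurable_cong_sets[OF circle_probD(2)[OF assms(1)] refl] by blast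
qed

lemma continuous_on_circle_power:
  assumes "continuous_on unit_circle f"
  shows "continuous_on unit_circle (\<lambda>z. f (z ^ d))"
  by (rule continuous_on_compose2[OF assms]) (auto intro!: continuous_intros simp: norm_power)

lemma subconformal_iff:
  "subconformal \<beta> \<nu> \<longleftrightarrow> (\<forall>f n. n > 0 \<longrightarrow> continuous_on unit_circle f \<longrightarrow> (\<forall>z\<in>unit_circle. f z \<ge> 0) \<longrightarrow>
     moebius_sum n (\<lambda>d. real d powr (- \<beta>) * (\<integral>z. f (z ^ d) \<partial>\<nu>)) \<ge> 0)"
  unfolding subconformal_def moebius_sum_def mult.assoc by blast

text \<open>In operator form: \<open>\<Prod>p dvd n. (1 - p powr (- s) * P p)\<close> times \<open>\<Prod>p dvd m. (1 - p powr (- \<beta>) * P p)\<close> is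
positive on \<open>\<nu>\<close>. The induction moves primes from the second product to the first one, using
\<open>1 - p powr (- s) * P p = (1 - p powr (- \<beta>) * P p) + (p powr (- \<beta>) - p powr (- s)) * P p\<close>. Since \<open>P p\<close> is composition
of the test function with \<open>z \<mapsto> z ^ p\<close>, the statement is made for all test functions at once.\<close>
lemma subconformal_mixed_exponents:
  assumes sub: "subconformal \<beta> \<nu>" and s: "\<beta> \<le> s" and n: "n > 0"
    and m: "m > 0" "coprime m n"
    and f: "continuous_on unit_circle f" "\<And>z. z \<in> unit_circle \<Longrightarrow> f z \<ge> (0::real)"
  shows "moebius_sum n (\<lambda>d. real d powr (- s) *
    moebius_sum m (\<lambda>e. real e powr (- \<beta>) * (\<integral>z. f (z ^ (d * e)) \<partial>\<nu>))) \<ge> 0"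
  using n m f
proof (induction n arbitrary: m f rule: nat_prime_times_induct)
  case one
  then show ?case using sub by (simp add: subconformal_iff)
next
  case (prime_times p n)
  define H where "H m f d = moebius_sum m (\<lambda>e. real e powr (- \<beta>) * (\<integral>z. f (z ^ (d * e)) \<partial>\<nu>))"
    for m d :: nat and f :: "complex \<Rightarrow> real"
  have IH: "moebius_sum n (\<lambda>d. real d powr (- s) * H m f d) \<ge> 0"
    if "m > 0" "coprime m n" "continuous_on unit_circle f" "\<And>z. z \<in> unit_circle \<Longrightarrow> f z \<ge> 0" for m f
    using prime_times.IH[OF that] by (simp add: H_def)
  have cop: "coprime m p" "coprime m n" using prime_times.prems by auto
  show ?case
  proof (cases "p dvd n")
    case True
    then show ?thesis
      using moebius_sum_prime_times[OF prime_times(1,2)] IH[OF _ cop(2)] prime_times.prems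
      by (simp add: H_def)
  next
    case False
    \<comment> \<open>The last summand of the decomposition is non-negative by the induction hypothesis for this test function.\<close>
    define f' where "f' = (\<lambda>z. f (z ^ p))"
    have f': "continuous_on unit_circle f'" "\<And>z. z \<in> unit_circle \<Longrightarrow> f' z \<ge> 0"
      using prime_times.prems continuous_on_circle_power power_in_circle unfolding f'_def by blast+
    have "\<not> p dvd m" using cop(1) prime_times(1)
      by (metis coprime_absorb_left coprime_commute not_prime_unit)
    have shift: "H m f (p * d) = H m f' d" for d
      by (simp add: H_def f'_def mult_ac flip: power_mult)
    define a b where "a = moebius_sum n (\<lambda>d. real d powr (- s) * H m f d)"
      and "b = moebius_sum n (\<lambda>d. real d powr (- s) * H m f' d)"
    have Hpm: "H (p * m) f d = H m f d - real p powr (- \<beta>) * H m f' d" for d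
    proof -
      have "H (p * m) f d = H m f d - moebius_sum m (\<lambda>e. real (p * e) powr (- \<beta>) * (\<integral>z. f (z ^ (d * (p * e))) \<partial>\<nu>))"
        unfolding H_def using \<open>\<not> p dvd m\<close> prime_times.prems(1)
        by (subst moebius_sum_prime_times[OF prime_times(1)]) auto
      also have "moebius_sum m (\<lambda>e. real (p * e) powr (- \<beta>) * (\<integral>z. f (z ^ (d * (p * e))) \<partial>\<nu>)) =
          real p powr (- \<beta>) * H m f' d"
        unfolding H_def moebius_sum_mult_left[symmetric]
        by (intro moebius_sum_cong) (simp add: powr_mult f'_def mult_ac flip: power_mult)
      finally show ?thesis .
    qed
    have "0 \<le> moebius_sum n (\<lambda>d. real d powr (- s) * H (p * m) f d)"
      using prime_times False \<open>m > 0\<close> cop prime_gt_0_nat[OF prime_times(1)]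
      by (intro IH) (auto simp: prime_imp_coprime)
    also have "\<dots> = moebius_sum n (\<lambda>d. real d powr (- s) * H m f d -
        real p powr (- \<beta>) * (real d powr (- s) * H m f' d))"
      by (intro moebius_sum_cong) (simp only: Hpm, simp add: algebra_simps)
    also have "\<dots> = a - real p powr (- \<beta>) * b"
      by (simp only: moebius_sum_diff moebius_sum_mult_left a_def b_def)
    finally have 1: "0 \<le> a - real p powr (- \<beta>) * b" .
    have "b \<ge> 0" unfolding b_def using prime_times.prems cop f' by (intro IH) auto
    moreover have "real p powr (- s) \<le> real p powr (- \<beta>)"
      using s prime_ge_1_nat[OF prime_times(1)] by (intro powr_mono) auto
    ultimately have 2: "real p powr (- s) * b \<le> real p powr (- \<beta>) * b" by (rule mult_right_mono[rotated])
    have "moebius_sum (p * n) (\<lambda>d. real d powr (- s) * H m f d) =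
        a - moebius_sum n (\<lambda>d. real (p * d) powr (- s) * H m f (p * d))"
      using moebius_sum_prime_times[OF prime_times(1,2)] False by (simp add: a_def)
    also have "moebius_sum n (\<lambda>d. real (p * d) powr (- s) * H m f (p * d)) = real p powr (- s) * b"
      unfolding b_def moebius_sum_mult_left[symmetric]
      by (intro moebius_sum_cong) (simp add: powr_mult shift)
    finally show ?thesis using 1 2 by (simp add: H_def)
  qed
qed

lemma subconformal_mono:
  assumes "subconformal \<beta> \<nu>" "\<beta> \<le> s"
  shows "subconformal s \<nu>"
  unfolding subconformal_iff
proof (intro allI impI)
  fix f :: "complex \<Rightarrow> real" and n :: nat
  assume "n > 0" "continuous_on unit_circle f" "\<forall>z\<in>unit_circle. f z \<ge> 0"
  then show "moebius_sum n (\<lambda>d. real d powr (- s) * (\<integral>z. f (z ^ d) \<partial>\<nu>)) \<ge> 0"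
    using subconformal_mixed_exponents[OF assms, of n 1 f] by simp
qed

lemma subconformal_point:
  assumes \<nu>: "circle_prob \<nu>" and sub: "subconformal \<beta> \<nu>" and n: "n > 0"
  shows "moebius_sum n (\<lambda>d. real d powr (- \<beta>) * measure \<nu> (power_preimage d {u})) \<ge> 0"
proof -
  interpret prob_space \<nu> using circle_probD(1)[OF \<nu>] .
  \<comment> \<open>Continuous tent functions decreasing to the indicator of the point u.\<close>
  define f where "f j z = max 0 (1 - real j * norm (z - u))" for j :: nat and z
  have cont: "continuous_on unit_circle (f j)" for j
    unfolding f_def by (intro continuous_intros)
  have lim: "(\<lambda>j. f j z) \<longlonglongrightarrow> indicator {u} z" for z
  proof (cases "z = u")
    case False
    then have "norm (z - u) > 0" by simp
    then obtain N :: nat where N: "1 < real N * norm (z - u)" using ex_less_of_nat_mult by blast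
    have "f j z = 0" if "j \<ge> N" for j
    proof -
      have "real N * norm (z - u) \<le> real j * norm (z - u)" using that by (intro mult_right_mono) auto
      then show ?thesis using N by (simp add: f_def)
    qed
    then have "\<forall>\<^sub>F j in sequentially. f j z = 0" unfolding eventually_sequentially by blast
    then show ?thesis using False by (simp add: tendsto_eventually)
  qed (simp add: f_def)
  have "(\<lambda>j. \<integral>z. f j (z ^ d) \<partial>\<nu>) \<longlonglongrightarrow> measure \<nu> (power_preimage d {u})" if "d dvd n" for d
  proof -
    have d: "d > 0" using that n by (auto intro!: Nat.gr0I)
    have meas: "power_preimage d {u} \<in> sets \<nu>"
      using finite_power_preimage[OF _ d, of "{u}"] power_preimage_subset
      by (intro countable_in_sets_circle[OF \<nu>]) (auto simp: countable_finite)
    have "(\<lambda>j. \<integral>z. f j (z ^ d) \<partial>\<nu>) \<longlonglongrightarrow> (\<integral>z. indicator (power_preimage d {u}) z \<partial>\<nu>)"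
    proof (rule integral_dominated_convergence[where w = "\<lambda>_. 1"])
      show "(\<lambda>z. f j (z ^ d)) \<in> borel_measurable \<nu>" for j
        by (intro continuous_circle_measurable[OF \<nu>] continuous_on_circle_power cont)
      show "AE z in \<nu>. (\<lambda>j. f j (z ^ d)) \<longlonglongrightarrow> indicator (power_preimage d {u}) z"
      proof (rule AE_I2)
        fix z assume "z \<in> space \<nu>"
        then have "indicator (power_preimage d {u}) z = (indicator {u} (z ^ d) :: real)"
          using circle_probD(3)[OF \<nu>] by (simp add: indicator_def power_preimage_def)
        then show "(\<lambda>j. f j (z ^ d)) \<longlonglongrightarrow> indicator (power_preimage d {u}) z" using lim by simp
      qed
      show "AE z in \<nu>. norm (f j (z ^ d)) \<le> 1" for j by (auto simp: f_def)
    qed (use meas in auto)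
    then show ?thesis using meas by simp
  qed
  then have "(\<lambda>j. moebius_sum n (\<lambda>d. real d powr (- \<beta>) * (\<integral>z. f j (z ^ d) \<partial>\<nu>))) \<longlonglongrightarrow>
      moebius_sum n (\<lambda>d. real d powr (- \<beta>) * measure \<nu> (power_preimage d {u}))"
    unfolding moebius_sum_def by (intro tendsto_sum tendsto_mult tendsto_const) auto
  moreover have "moebius_sum n (\<lambda>d. real d powr (- \<beta>) * (\<integral>z. f j (z ^ d) \<partial>\<nu>)) \<ge> 0" for j
  proof -
    have "\<forall>z\<in>unit_circle. f j z \<ge> 0" by (simp add: f_def)
    then show ?thesis using sub n cont[of j] unfolding subconformal_iff by blast
  qed
  ultimately show ?thesis by (intro tendsto_lowerbound[of _ _ sequentially]) auto
qed

lemma subconformal_finite_set: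
  assumes \<nu>: "circle_prob \<nu>" and sub: "subconformal \<beta> \<nu>" and n: "n > 0" and E: "finite E"
  shows "moebius_sum n (\<lambda>d. real d powr (- \<beta>) * measure \<nu> (power_preimage d E)) \<ge> 0"
proof -
  have "moebius_sum n (\<lambda>d. real d powr (- \<beta>) * measure \<nu> (power_preimage d E)) =
      moebius_sum n (\<lambda>d. \<Sum>u\<in>E. real d powr (- \<beta>) * measure \<nu> (power_preimage d {u}))"
    using n by (intro moebius_sum_cong)
      (auto simp: measure_power_preimage_sum[OF \<nu> E] sum_distrib_left intro!: Nat.gr0I)
  also have "\<dots> = (\<Sum>u\<in>E. moebius_sum n (\<lambda>d. real d powr (- \<beta>) * measure \<nu> (power_preimage d {u})))"
    unfolding moebius_sum_def sum_distrib_left by (rule sum.swap)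
  also have "\<dots> \<ge> 0" by (intro sum_nonneg subconformal_point[OF \<nu> sub n])
  finally show ?thesis .
qed

text \<open>One prime at a time: subconformality at \<open>n = p\<close> says that the mass of \<open>w ^ p\<close> is at least \<open>1 / p\<close> times the
mass of all \<open>p\<close>-th roots of \<open>w ^ p\<close>, among them \<open>w\<close>.\<close>
lemma subconformal_atom_power:
  assumes \<nu>: "circle_prob \<nu>" and sub: "subconformal 1 \<nu>" and m: "m > 0"
    and z: "z \<in> unit_circle"
  shows "measure \<nu> {z} / m \<le> measure \<nu> {z ^ m}"
  using m z
proof (induction m arbitrary: z rule: nat_prime_times_induct)
  case (prime_times p m)
  interpret prob_space \<nu> using circle_probD(1)[OF \<nu>] .
  define w where "w = z ^ m"
  have w: "w \<in> unit_circle" using power_in_circle prime_times.prems by (simp add: w_def)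
  have p: "p > 0" using prime_times prime_gt_0_nat by blast
  have "moebius_sum (p * 1) (\<lambda>d. real d powr (- 1) * measure \<nu> (power_preimage d {w ^ p})) \<ge> 0"
    using p by (intro subconformal_point[OF \<nu> sub]) auto
  also have "moebius_sum (p * 1) (\<lambda>d. real d powr (- 1) * measure \<nu> (power_preimage d {w ^ p})) =
      measure \<nu> {w ^ p} - measure \<nu> (power_preimage p {w ^ p}) / p"
    using prime_times(1) p power_in_circle[OF w, of p]
    by (subst moebius_sum_prime_times) (auto simp: powr_minus_divide)
  finally have "measure \<nu> (power_preimage p {w ^ p}) / p \<le> measure \<nu> {w ^ p}" by simp
  moreover have "measure \<nu> {w} \<le> measure \<nu> (power_preimage p {w ^ p})"
  proof (rule finite_measure_mono)
    show "power_preimage p {w ^ p} \<in> sets \<nu>"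
      using finite_power_preimage[OF _ p, of "{w ^ p}"] power_preimage_subset
      by (intro countable_in_sets_circle[OF \<nu>]) (auto simp: countable_finite)
  qed (use w in \<open>auto simp: power_preimage_def\<close>)
  moreover have "measure \<nu> {z} / m / p \<le> measure \<nu> {w} / p"
    using prime_times p unfolding w_def by (intro divide_right_mono) auto
  ultimately have "measure \<nu> {z} / m / p \<le> measure \<nu> {w ^ p}"
    using divide_right_mono[of "measure \<nu> {w}" "measure \<nu> (power_preimage p {w ^ p})" "real p"] by linarith
  moreover have "w ^ p = z ^ (p * m)" by (simp add: w_def mult.commute flip: power_mult)
  ultimately show ?case by (simp add: mult.commute)
qed auto

lemma harmonic_bounded_imp_zero:
  fixes c :: real
  assumes "c \<ge> 0" "\<And>N. c * (\<Sum>i=1..N. 1 / real i) \<le> B"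
  shows "c = 0"
proof (rule ccontr)
  assume "c \<noteq> 0"
  then have c: "c > 0" using assms by simp
  have "\<forall>\<^sub>F N in sequentially. B / c < harm N"
    using harm_at_top unfolding filterlim_at_top_dense by blast
  then obtain N where "B / c < (harm N :: real)" unfolding eventually_sequentially by blast
  then have "B < c * (\<Sum>i=1..N. 1 / real i)"
    using c by (simp add: harm_def field_simps inverse_eq_divide)
  then show False using assms(2)[of N] by simp
qed

text \<open>The powers of \<open>z\<close> are distinct atoms with masses at least \<open>measure \<nu> {z} / m\<close>, whose sum would be
infinite.\<close>
lemma subconformal_infinite_order_null:
  assumes \<nu>: "circle_prob \<nu>" and sub: "subconformal 1 \<nu>"
    and z: "z \<in> unit_circle" "unit_ord z = 0"
  shows "measure \<nu> {z} = 0"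
proof (rule harmonic_bounded_imp_zero[where B = 1])
  interpret prob_space \<nu> using circle_probD(1)[OF \<nu>] .
  fix N :: nat
  have inj: "inj_on (\<lambda>m. z ^ m) {1..N}"
  proof -
    have "z \<noteq> 0" using z(1) by auto
    have "i = j" if "z ^ i = z ^ j" "i \<le> j" for i j
    proof -
      have "z ^ i * z ^ (j - i) = z ^ j" using that(2) by (simp flip: power_add)
      then have "z ^ (j - i) = 1" using \<open>z \<noteq> 0\<close> that(1) by simp
      then show ?thesis using that(2) z(2) unfolding power_eq_1_iff_unit_ord_dvd by simp
    qed
    then show ?thesis by (intro inj_onI) (metis nat_le_linear)
  qed
  have "measure \<nu> {z} * (\<Sum>i=1..N. 1 / real i) = (\<Sum>i=1..N. measure \<nu> {z} / real i)"
    by (simp add: sum_distrib_left)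
  also have "\<dots> \<le> (\<Sum>i=1..N. measure \<nu> {z ^ i})"
    using z by (intro sum_mono subconformal_atom_power[OF \<nu> sub]) auto
  also have "\<dots> = (\<Sum>w\<in>(\<lambda>m. z ^ m) ` {1..N}. measure \<nu> {w})"
    using inj by (simp add: sum.reindex)
  also have "\<dots> = measure \<nu> ((\<lambda>m. z ^ m) ` {1..N})"
    using z power_in_circle
    by (intro finite_measure_eq_sum_singleton[symmetric] countable_in_sets_circle[OF \<nu>]) auto
  also have "\<dots> \<le> 1" by simp
  finally show "measure \<nu> {z} * (\<Sum>i=1..N. 1 / real i) \<le> 1" .
qed simp

section \<open>Uniformity on the primitive roots of each order\<close>

lemma summable_on_powr:
  assumes "s > 1"
  shows "(\<lambda>n. real n powr (- s)) summable_on A"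
proof (rule summable_on_subset_banach)
  have "summable (\<lambda>n. norm (real n powr (- s)))"
    using assms summable_real_powr_iff[of "- s"] by simp
  then show "(\<lambda>n. real n powr (- s)) summable_on UNIV" by (rule norm_summable_imp_summable_on)
qed simp

lemma summable_on_omega_powr:
  assumes "s > 1"
  shows "(\<lambda>m. 2 ^ card (prime_factors m) * real m powr (- s)) summable_on {0<..}"
proof -
  define e where "e = (s - 1) / 2"
  have e: "e > 0" "s - e > 1" using assms by (auto simp: e_def field_simps)
  obtain C where C: "C > 0" "\<And>m. m > 0 \<Longrightarrow> 2 ^ card (prime_factors m) \<le> C * totient_powr e m"
    using two_power_omega_le_totient_powr[OF e(1)] by blast
  show ?thesis
  proof (rule summable_on_comparison_test)
    show "(\<lambda>m. C * real m powr (- (s - e))) summable_on {0<..}"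
      using summable_on_powr[OF e(2)] by (rule summable_on_cmult_right)
    fix m :: nat assume "m \<in> {0<..}"
    then have m: "m > 0" by simp
    have "2 ^ card (prime_factors m) \<le> C * real m powr e"
      using C(2)[OF m] totient_powr_le[OF e(1) m] C(1) by (meson mult_left_mono less_imp_le order_trans)
    then have "2 ^ card (prime_factors m) * real m powr (- s) \<le> C * real m powr e * real m powr (- s)"
      by (rule mult_right_mono) simp
    also have "\<dots> = C * real m powr (- (s - e))" by (simp flip: powr_add)
    finally show "2 ^ card (prime_factors m) * real m powr (- s) \<le> C * real m powr (- (s - e))" .
  qed simp
qed

definition exponents :: "complex \<Rightarrow> complex \<Rightarrow> nat set" where
  "exponents z u = {m. m > 0 \<and> z ^ m = u}"

text \<open>If \<open>z\<close> has finite order and \<open>u\<close> is a power of \<open>z\<close>, the exponents form a residue class modulo the order.\<close>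
lemma exponents_progression:
  assumes l: "unit_ord z > 0" and ne: "exponents z u \<noteq> {}"
  obtains m0 where "m0 > 0" "m0 \<le> unit_ord z" "z ^ m0 = u"
    "exponents z u = range (\<lambda>i. m0 + i * unit_ord z)"
proof -
  define l where "l = unit_ord z"
  have l0: "l > 0" using l by (simp add: l_def)
  have z0: "z \<noteq> 0" using l unit_ord_pos_nonzero by blast
  have zl: "z ^ l = 1" by (simp add: l_def)
  \<comment> \<open>The least positive exponent; it may equal the order itself, when u = 1.\<close>
  define m0 where "m0 = (LEAST m. m \<in> exponents z u)"
  have m0: "m0 \<in> exponents z u" unfolding m0_def by (rule LeastI_ex) (use ne in blast)
  have least: "m0 \<le> m" if "m \<in> exponents z u" for m unfolding m0_def using that by (rule Least_le)
  have "m0 \<le> l"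
  proof (rule ccontr)
    assume "\<not> m0 \<le> l"
    then have "(m0 - l) + l = m0" "m0 - l > 0" by simp_all
    then have "z ^ m0 = z ^ (m0 - l) * z ^ l" by (metis power_add)
    then have "z ^ (m0 - l) = z ^ m0" unfolding zl by simp
    then have "m0 - l \<in> exponents z u" using m0 \<open>m0 - l > 0\<close> unfolding exponents_def by simp
    then show False using least[of "m0 - l"] l0 \<open>\<not> m0 \<le> l\<close> by linarith
  qed
  have "exponents z u = (\<lambda>i. m0 + i * l) ` UNIV"
  proof (intro equalityI subsetI)
    fix m assume m: "m \<in> exponents z u"
    have "z ^ m0 * z ^ (m - m0) = z ^ m" using least[OF m] by (simp flip: power_add)
    also have "\<dots> = z ^ m0" using m m0 by (simp add: exponents_def)
    finally have "z ^ (m - m0) = 1" using z0 by simp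
    then obtain i where "m - m0 = l * i" unfolding power_eq_1_iff_unit_ord_dvd l_def[symmetric] by blast
    then have "m = m0 + i * l" using least[OF m] by (metis le_add_diff_inverse mult.commute)
    then show "m \<in> (\<lambda>i. m0 + i * l) ` UNIV" by blast
  next
    fix m assume "m \<in> (\<lambda>i. m0 + i * l) ` UNIV"
    then obtain i where "m = m0 + l * i" by (auto simp: mult.commute)
    then have "z ^ m = z ^ m0" using zl by (simp add: power_add power_mult)
    then show "m \<in> exponents z u" using m0 \<open>m = m0 + l * i\<close> by (simp add: exponents_def)
  qed
  then show ?thesis using that[of m0] m0 \<open>m0 \<le> l\<close> unfolding l_def exponents_def by blast
qed

text \<open>The Riemann zeta function at a real \<open>s > 1\<close>.\<close>
definition zeta_sum :: "real \<Rightarrow> real" where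
  "zeta_sum s = (\<Sum>i. real (Suc i) powr (- s))"

lemma of_nat_powr_neg_mono:
  assumes "0 < m" "m \<le> n" "s \<ge> 0"
  shows "real n powr (- s) \<le> real m powr (- s)"
  using assms by (intro powr_mono2') auto

lemma summable_powr_progression:
  assumes "s > 1" "l > 0"
  shows "summable (\<lambda>i. real (a + i * l) powr (- s))"
proof (rule summable_comparison_test')
  show "summable (\<lambda>i. real i powr (- s))" using assms summable_real_powr_iff[of "- s"] by simp
  fix i :: nat assume "i \<ge> 1"
  moreover have "i \<le> a + i * l" using assms by (cases l) auto
  ultimately have "real (a + i * l) powr (- s) \<le> real i powr (- s)"
    using assms by (intro of_nat_powr_neg_mono) simp_all
  then show "norm (real (a + i * l) powr (- s)) \<le> real i powr (- s)" by simp
qed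

text \<open>Let \<open>l\<close> be the order of \<open>z\<close>, and \<open>a\<close>, \<open>b\<close> the least exponents producing \<open>u\<close>, \<open>u'\<close>. Since \<open>b \<le> l\<close>, the terms
\<open>a + l, a + 2 * l, ...\<close> are dominated by \<open>b, b + l, ...\<close>, so the sum for \<open>u\<close> exceeds that for \<open>u'\<close> by at most
\<open>a powr (- s)\<close>. This excess is small relative to the sum for \<open>u'\<close>: \<open>l dvd a * k\<close> yields \<open>a \<ge> l / k\<close>, whereas \<open>b \<le> l\<close> yields that
the sum for \<open>u'\<close> is at least \<open>l powr (- s) * zeta_sum s\<close>. The bound on the ratio does not involve \<open>z\<close>.\<close>
lemma exponent_sum_comparison:
  fixes z u u' :: complex
  assumes s: "s > 1" and u: "u \<in> primitive_roots k" "u' \<in> primitive_roots k"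
  defines "K \<equiv> \<lambda>v. \<Sum>\<^sub>\<infinity>m\<in>exponents z v. real m powr (- s)"
  shows "zeta_sum s * K u \<le> (zeta_sum s + real k powr s) * K u'"
proof (cases "exponents z u = {}")
  case True
  have "K u' \<ge> 0" unfolding K_def by (intro infsum_nonneg) auto
  moreover have "zeta_sum s \<ge> 0"
    unfolding zeta_sum_def using summable_powr_progression[OF s, of 1 1] by (intro suminf_nonneg) auto
  moreover have "K u = 0" using True by (simp add: K_def)
  ultimately show ?thesis by simp
next
  case False
  define l where "l = unit_ord z"
  have k: "k > 0" using u by (simp add: primitive_roots_iff)
  from False obtain m where m: "m > 0" "z ^ m = u" by (auto simp: exponents_def)
  then have "z ^ (m * k) = 1" "m * k > 0" using u(1) by (auto simp: power_mult primitive_roots_def)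
  then have l: "unit_ord z > 0" unfolding unit_ord_pos_iff by blast
  obtain r where r: "u' = u ^ r" "r > 0" using primitive_roots_transitive[OF u] by blast
  have "m * r \<in> exponents z u'" using m r by (simp add: exponents_def power_mult)
  then have False': "exponents z u' \<noteq> {}" by blast
  have K_suminf: "\<exists>m0>0. m0 \<le> l \<and> z ^ m0 = v \<and> K v = (\<Sum>i. real (m0 + i * l) powr (- s))"
    if ne: "exponents z v \<noteq> {}" for v
  proof -
    obtain m0 where m0: "m0 > 0" "m0 \<le> unit_ord z" "z ^ m0 = v"
      "exponents z v = range (\<lambda>i. m0 + i * l)"
      using exponents_progression[OF l ne] unfolding l_def by blast
    have inj: "inj (\<lambda>i. m0 + i * l)" using l by (auto intro: injI simp: l_def)
    have "((\<lambda>m. real m powr (- s)) has_sum K v) (exponents z v)"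
      unfolding K_def using summable_on_powr[OF s] by (rule has_sum_infsum)
    then have "((\<lambda>i. real (m0 + i * l) powr (- s)) has_sum K v) UNIV"
      unfolding m0(4) has_sum_reindex[OF inj] o_def .
    then have "K v = (\<Sum>i. real (m0 + i * l) powr (- s))" using has_sum_imp_sums sums_unique by blast
    then show ?thesis using m0 unfolding l_def by blast
  qed
  obtain a where a: "a > 0" "a \<le> l" "z ^ a = u" "K u = (\<Sum>i. real (a + i * l) powr (- s))"
    using K_suminf[OF False] by blast
  obtain b where b: "b > 0" "b \<le> l" "z ^ b = u'" "K u' = (\<Sum>i. real (b + i * l) powr (- s))"
    using K_suminf[OF False'] by blast
  have l0: "l > 0" using l by (simp add: l_def)
  note summ = summable_powr_progression[OF s l0]
  have "(\<Sum>i. real (a + i * l) powr (- s)) = real a powr (- s) + (\<Sum>i. real (a + Suc i * l) powr (- s))"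
    using suminf_split_head[OF summ[of a]] by simp
  also have "(\<Sum>i. real (a + Suc i * l) powr (- s)) \<le> (\<Sum>i. real (b + i * l) powr (- s))"
  proof (rule suminf_le)
    show "summable (\<lambda>i. real (a + Suc i * l) powr (- s))" using summ[of "a + l"] by (simp add: add_ac)
    show "real (a + Suc i * l) powr (- s) \<le> real (b + i * l) powr (- s)" for i
    proof (rule of_nat_powr_neg_mono)
      show "b + i * l \<le> a + Suc i * l" using b(2) by simp
    qed (use b s in auto)
  qed (rule summ)
  finally have Ku: "K u \<le> real a powr (- s) + K u'" using a b by simp
  have "z ^ (a * k) = 1" using a(3) u(1) by (simp add: power_mult primitive_roots_def)
  then have "l dvd a * k" unfolding power_eq_1_iff_unit_ord_dvd l_def .
  then have "l \<le> a * k" using a k by (auto dest: dvd_imp_le)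
  then have "(real a * real k) powr (- s) \<le> real l powr (- s)"
    using of_nat_powr_neg_mono[of l "a * k" s] l0 s by simp
  then have "real a powr (- s) \<le> real k powr s * real l powr (- s)"
    using k a by (simp add: powr_mult powr_minus field_simps)
  note a_le = this
  have Z: "zeta_sum s \<ge> 0"
    unfolding zeta_sum_def using summable_powr_progression[OF s, of 1 1] by (intro suminf_nonneg) auto
  have "zeta_sum s * real a powr (- s) \<le> real k powr s * (real l powr (- s) * zeta_sum s)"
    using mult_left_mono[OF a_le Z] by (simp only: mult_ac)
  also have "real k powr s * (real l powr (- s) * zeta_sum s) \<le> real k powr s * K u'"
  proof (rule mult_left_mono)
    have "real l powr (- s) * zeta_sum s = (\<Sum>i. real l powr (- s) * real (Suc i) powr (- s))"
      unfolding zeta_sum_def using summable_powr_progression[OF s, of 1 1] by (simp add: suminf_mult)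
    also have "\<dots> = (\<Sum>i. real (l + i * l) powr (- s))"
      by (intro suminf_cong) (simp add: powr_mult[symmetric] algebra_simps)
    also have "\<dots> \<le> (\<Sum>i. real (b + i * l) powr (- s))"
      using b s by (intro suminf_le summ of_nat_powr_neg_mono) auto
    finally show "real l powr (- s) * zeta_sum s \<le> K u'" using b by simp
  qed simp
  finally have "zeta_sum s * real a powr (- s) \<le> real k powr s * K u'" .
  moreover have "zeta_sum s * K u \<le> zeta_sum s * (real a powr (- s) + K u')"
    using Ku Z by (rule mult_left_mono)
  ultimately show ?thesis by (simp add: distrib_left distrib_right)
qed

lemma has_sum_sum:
  assumes "finite E" "\<And>z. z \<in> E \<Longrightarrow> (f z has_sum S z) A"
  shows "((\<lambda>x. \<Sum>z\<in>E. (f z x :: real)) has_sum (\<Sum>z\<in>E. S z)) A"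
  using assms by (induction E rule: finite_induct) (auto intro!: has_sum_add has_sum_0)

text \<open>The point mass at \<open>z\<close> of the infinite product \<open>\<Prod>p. (1 - p powr (- s) * P p)\<close> applied to \<open>\<nu>\<close>, where \<open>P p\<close> is
push-forward along \<open>z \<mapsto> z ^ p\<close>.\<close>
definition moebius_atom :: "complex measure \<Rightarrow> real \<Rightarrow> complex \<Rightarrow> real" where
  "moebius_atom \<nu> s z =
    (\<Sum>\<^sub>\<infinity>d\<in>{0<..}. of_int (moebius_mu d) * (real d powr (- s) * measure \<nu> (power_preimage d {z})))"

lemma moebius_atom_summable:
  assumes \<nu>: "circle_prob \<nu>" and s: "s > 1"
  shows "(\<lambda>d. of_int (moebius_mu d) * (real d powr (- s) * measure \<nu> (power_preimage d {z}))) summable_on {0<..}"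
proof (rule abs_summable_summable, rule summable_on_comparison_test[OF summable_on_powr[OF s]])
  interpret prob_space \<nu> using circle_probD(1)[OF \<nu>] .
  fix d :: nat
  have "\<bar>real_of_int (moebius_mu d)\<bar> * (real d powr (- s) * measure \<nu> (power_preimage d {z})) \<le>
      1 * (real d powr (- s) * 1)"
    using moebius_mu_abs_le by (intro mult_mono) auto
  then show "norm (of_int (moebius_mu d) * (real d powr (- s) * measure \<nu> (power_preimage d {z}))) \<le> real d powr (- s)"
    by (simp add: abs_mult)
qed simp

lemma moebius_atom_nonneg:
  assumes \<nu>: "circle_prob \<nu>" and s: "s > 1" and sub: "subconformal s \<nu>"
  shows "moebius_atom \<nu> s z \<ge> 0"
  unfolding moebius_atom_def
  by (intro infsum_moebius_nonneg subconformal_point[OF \<nu> sub] moebius_atom_summable[OF \<nu> s])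

text \<open>Inverting the infinite product gives \<open>\<nu> {v} = \<Sum>m. m powr (- s) * (\<Sum>z ^ m = v. moebius_atom \<nu> s z)\<close>; exchanging
the two sums, which is allowed by positivity, collects the exponents belonging to each \<open>z\<close>.\<close>
lemma atom_eq_sum_moebius_atoms:
  assumes \<nu>: "circle_prob \<nu>" and s: "s > 1" and sub: "subconformal s \<nu>" and v: "v \<in> unit_circle"
  shows "((\<lambda>z. moebius_atom \<nu> s z * (\<Sum>\<^sub>\<infinity>m\<in>exponents z v. real m powr (- s))) has_sum measure \<nu> {v}) unit_circle"
proof -
  interpret prob_space \<nu> using circle_probD(1)[OF \<nu>] .
  define q where "q d E = measure \<nu> (power_preimage d E)" for d E
  define G where "G m = real m powr (- s) * q m {v}" for m
  have q: "0 \<le> q d E" "q d E \<le> 1" for d E by (auto simp: q_def)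
  have "((\<lambda>(m, d). of_int (moebius_mu d) * G (m * d)) has_sum G 1) ({0<..} \<times> {0<..})"
  proof (rule moebius_inversion)
    show "(\<lambda>m. 2 ^ card (prime_factors m) * G m) summable_on {0<..}"
      by (rule summable_on_comparison_test[OF summable_on_omega_powr[OF s]])
        (auto simp: G_def q mult_left_le)
  qed (auto simp: G_def q)
  moreover have "G 1 = measure \<nu> {v}" using v by (simp add: G_def q_def)
  ultimately have pairs: "((\<lambda>(m, d). of_int (moebius_mu d) * G (m * d)) has_sum measure \<nu> {v}) ({0<..} \<times> {0<..})" by simp
  \<comment> \<open>The terms of the inverted series, before the exchange of summation.\<close>
  define T where "T m = (\<Sum>z\<in>power_preimage m {v}. real m powr (- s) * moebius_atom \<nu> s z)" for m
  have "(T has_sum measure \<nu> {v}) {0<..}"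
  proof (rule has_sum_SigmaD[OF pairs])
    fix m :: nat assume "m \<in> {0<..}"
    then have m: "m > 0" by simp
    have fin: "finite (power_preimage m {v})" using finite_power_preimage[OF _ m] by simp
    have "((\<lambda>d. \<Sum>z\<in>power_preimage m {v}. real m powr (- s) * (of_int (moebius_mu d) * (real d powr (- s) * q d {z})))
        has_sum T m) {0<..}"
      unfolding T_def q_def moebius_atom_def
      by (intro has_sum_sum[OF fin] has_sum_cmult_right has_sum_infsum moebius_atom_summable[OF \<nu> s])
    then show "((\<lambda>d. case (m, d) of (m, d) \<Rightarrow> of_int (moebius_mu d) * G (m * d)) has_sum T m) {0<..}"
    proof (rule has_sum_cong[THEN iffD1, rotated])
      fix d :: nat assume "d \<in> {0<..}"
      then have "q (m * d) {v} = (\<Sum>z\<in>power_preimage m {v}. q d {z})"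
        unfolding q_def
        by (subst measure_power_preimage_sum[OF \<nu> fin, symmetric])
           (auto simp: power_preimage_preimage mult.commute)
      then show "(\<Sum>z\<in>power_preimage m {v}. real m powr (- s) * (of_int (moebius_mu d) * (real d powr (- s) * q d {z}))) =
          (case (m, d) of (m, d) \<Rightarrow> of_int (moebius_mu d) * G (m * d))"
        by (simp add: G_def powr_mult sum_distrib_left mult_ac)
    qed
  qed
  then have "((\<lambda>(m, z). real m powr (- s) * moebius_atom \<nu> s z) has_sum measure \<nu> {v})
      (Sigma {0<..} (\<lambda>m. power_preimage m {v}))"
  proof (intro has_sum_SigmaI)
    fix m :: nat assume "m \<in> {0<..}"
    then show "((\<lambda>z. case (m, z) of (m, z) \<Rightarrow> real m powr (- s) * moebius_atom \<nu> s z) has_sum T m) (power_preimage m {v})"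
      using finite_power_preimage[of "{v}" m] by (intro has_sum_finiteI) (auto simp: T_def)
  next
    assume T: "(T has_sum measure \<nu> {v}) {0<..}"
    then show "(T has_sum measure \<nu> {v}) {0<..}" .
    show "(\<lambda>(m, z). real m powr (- s) * moebius_atom \<nu> s z) summable_on Sigma {0<..} (\<lambda>m. power_preimage m {v})"
    proof (rule summable_on_SigmaI)
      fix m :: nat assume "m \<in> {0<..}"
      then show "((\<lambda>z. case (m, z) of (m, z) \<Rightarrow> real m powr (- s) * moebius_atom \<nu> s z) has_sum T m) (power_preimage m {v})"
        using finite_power_preimage[of "{v}" m] by (intro has_sum_finiteI) (auto simp: T_def)
    qed (use T moebius_atom_nonneg[OF \<nu> s sub] in \<open>auto intro: has_sum_imp_summable\<close>)
  qed
  also have "?this \<longleftrightarrow> ((\<lambda>(z, m). moebius_atom \<nu> s z * real m powr (- s)) has_sum measure \<nu> {v})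
      (Sigma unit_circle (\<lambda>z. exponents z v))"
    by (rule has_sum_reindex_bij_witness[of _ prod.swap prod.swap])
       (auto simp: power_preimage_def exponents_def)
  finally have swapped: "((\<lambda>(z, m). moebius_atom \<nu> s z * real m powr (- s)) has_sum measure \<nu> {v})
      (Sigma unit_circle (\<lambda>z. exponents z v))" .
  show ?thesis
    by (rule has_sum_SigmaD[OF swapped])
       (auto intro!: has_sum_cmult_right has_sum_infsum summable_on_powr[OF s])
qed

lemma subconformal_atom_comparison:
  assumes \<nu>: "circle_prob \<nu>" and s: "s > 1" and sub: "subconformal s \<nu>"
    and u: "u \<in> primitive_roots k" "u' \<in> primitive_roots k"
  shows "zeta_sum s * measure \<nu> {u} \<le> (zeta_sum s + real k powr s) * measure \<nu> {u'}"
proof (rule has_sum_mono)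
  have circle: "u \<in> unit_circle" "u' \<in> unit_circle" using u primitive_roots_subset_circle by blast+
  show "((\<lambda>z. zeta_sum s * (moebius_atom \<nu> s z * (\<Sum>\<^sub>\<infinity>m\<in>exponents z u. real m powr (- s))))
      has_sum zeta_sum s * measure \<nu> {u}) unit_circle"
    by (intro has_sum_cmult_right atom_eq_sum_moebius_atoms[OF \<nu> s sub] circle)
  show "((\<lambda>z. (zeta_sum s + real k powr s) * (moebius_atom \<nu> s z * (\<Sum>\<^sub>\<infinity>m\<in>exponents z u'. real m powr (- s))))
      has_sum (zeta_sum s + real k powr s) * measure \<nu> {u'}) unit_circle"
    by (intro has_sum_cmult_right atom_eq_sum_moebius_atoms[OF \<nu> s sub] circle)
  fix z
  show "zeta_sum s * (moebius_atom \<nu> s z * (\<Sum>\<^sub>\<infinity>m\<in>exponents z u. real m powr (- s))) \<le>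
      (zeta_sum s + real k powr s) * (moebius_atom \<nu> s z * (\<Sum>\<^sub>\<infinity>m\<in>exponents z u'. real m powr (- s)))"
    using mult_left_mono[OF exponent_sum_comparison[OF s u, of z] moebius_atom_nonneg[OF \<nu> s sub, of z]]
    by (simp add: mult_ac)
qed

text \<open>In the comparison for \<open>s > 1\<close>, a strict inequality would bound \<open>zeta_sum s\<close>, and with it each partial sum of
\<open>\<Sum>i. i powr (- s)\<close>, by a multiple of \<open>k powr s\<close>. Letting \<open>s\<close> decrease to \<open>1\<close> bounds the harmonic sums.\<close>
lemma subconformal_atom_le:
  assumes \<nu>: "circle_prob \<nu>" and sub: "subconformal 1 \<nu>"
    and u: "u \<in> primitive_roots k" "u' \<in> primitive_roots k"
  shows "measure \<nu> {u} \<le> measure \<nu> {u'}"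
proof (rule ccontr)
  interpret prob_space \<nu> using circle_probD(1)[OF \<nu>] .
  define \<delta> where "\<delta> = measure \<nu> {u} - measure \<nu> {u'}"
  assume "\<not> measure \<nu> {u} \<le> measure \<nu> {u'}"
  then have \<delta>: "\<delta> > 0" by (simp add: \<delta>_def)
  have k: "k > 0" using u by (simp add: primitive_roots_iff)
  have bound: "\<delta> * (\<Sum>i=1..N. real i powr (- s)) \<le> real k powr s" if s: "s > 1" for s N
  proof -
    have "zeta_sum s * \<delta> \<le> real k powr s * measure \<nu> {u'}"
      using subconformal_atom_comparison[OF \<nu> s subconformal_mono[OF sub] u] s
      by (simp add: \<delta>_def algebra_simps)
    also have "\<dots> \<le> real k powr s * 1" by (intro mult_left_mono) auto
    finally have "\<delta> * zeta_sum s \<le> real k powr s" by (simp add: mult.commute)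
    moreover have "(\<Sum>i=1..N. real i powr (- s)) \<le> zeta_sum s"
    proof -
      have "(\<Sum>i=1..N. real i powr (- s)) = (\<Sum>i<N. real (Suc i) powr (- s))"
        by (rule sum.reindex_bij_witness[of _ Suc "\<lambda>i. i - 1"]) auto
      also have "\<dots> \<le> zeta_sum s"
        unfolding zeta_sum_def using summable_powr_progression[OF s, of 1 1] by (intro sum_le_suminf) auto
      finally show ?thesis .
    qed
    ultimately show ?thesis using \<delta> by (meson mult_left_mono less_imp_le order_trans)
  qed
  have "\<delta> * (\<Sum>i=1..N. 1 / real i) \<le> real k" for N
  proof -
    have "((\<lambda>s. \<delta> * (\<Sum>i=1..N. real i powr (- s))) \<longlongrightarrow> \<delta> * (\<Sum>i=1..N. real i powr (- 1))) (at_right 1)"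
      by (intro tendsto_intros) auto
    moreover have "((\<lambda>s. real k powr s) \<longlongrightarrow> real k powr 1) (at_right 1)"
      using k by (intro tendsto_intros) auto
    moreover have "\<forall>\<^sub>F s in at_right 1. \<delta> * (\<Sum>i=1..N. real i powr (- s)) \<le> real k powr s"
      using eventually_at_right_less[of "1::real"] by eventually_elim (rule bound)
    ultimately have "\<delta> * (\<Sum>i=1..N. real i powr (- 1)) \<le> real k powr 1"
      by (intro tendsto_le[of "at_right (1::real)"]) auto
    then show ?thesis using k by (simp add: powr_minus_divide)
  qed
  then show False using harmonic_bounded_imp_zero[of \<delta> "real k"] \<delta> by simp
qed

section \<open>The measures \<open>nu_measure \<beta> n\<close>\<close>

lemma sets_nu_measure [simp]: "sets (nu_measure \<beta> n) = sets circle_borel"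
  by (simp add: nu_measure_def)

lemma space_nu_measure [simp]: "space (nu_measure \<beta> n) = unit_circle"
  by (simp add: nu_measure_def)

lemma measurable_nu_measure_id:
  "n > 0 \<Longrightarrow> (\<lambda>z. z) \<in> point_measure {z. z ^ n = 1} w \<rightarrow>\<^sub>M circle_borel"
  using roots_subset_unit_circle[of n] by (auto simp: measurable_point_measure_eq1)

lemma root_weight_nonneg: "\<beta> > 0 \<Longrightarrow> z ^ n = 1 \<Longrightarrow> n > 0 \<Longrightarrow> root_weight \<beta> z \<ge> 0"
  by (metis less_imp_le root_weight_pos unit_ord_pos_iff)

lemma finite_roots: "n > 0 \<Longrightarrow> finite {z::complex. z ^ n = 1}"
  using finite_roots_unity[of n] by simp

lemma emeasure_nu_measure:
  assumes \<beta>: "\<beta> > 0" and n: "n > 0" and A: "A \<in> sets circle_borel"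
  shows "emeasure (nu_measure \<beta> n) A =
    ennreal (real n powr (- \<beta>) * (\<Sum>z | z ^ n = 1 \<and> z \<in> A. root_weight \<beta> z))"
proof -
  define w where "w z = real n powr (- \<beta>) * root_weight \<beta> z" for z
  have fin: "finite {z::complex. z ^ n = 1}" using n by (rule finite_roots)
  have "emeasure (nu_measure \<beta> n) A = emeasure (point_measure {z. z ^ n = 1} (\<lambda>z. ennreal (w z))) (A \<inter> {z. z ^ n = 1})"
    unfolding nu_measure_def w_def root_weight_def
    using measurable_nu_measure_id[OF n] A by (simp add: emeasure_distr space_point_measure)
  also have "\<dots> = (\<Sum>z\<in>A \<inter> {z. z ^ n = 1}. ennreal (w z))"
    using fin by (intro emeasure_point_measure_finite) auto
  also have "\<dots> = ennreal (\<Sum>z\<in>A \<inter> {z. z ^ n = 1}. w z)"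
    using root_weight_nonneg[OF \<beta> _ n] by (intro sum_ennreal) (auto simp: w_def)
  also have "(\<Sum>z\<in>A \<inter> {z. z ^ n = 1}. w z) = real n powr (- \<beta>) * (\<Sum>z | z ^ n = 1 \<and> z \<in> A. root_weight \<beta> z)"
    unfolding w_def sum_distrib_left by (intro sum.cong) auto
  finally show ?thesis .
qed

lemma measure_nu_measure:
  assumes \<beta>: "\<beta> > 0" and n: "n > 0" and A: "A \<in> sets circle_borel"
  shows "measure (nu_measure \<beta> n) A =
    real n powr (- \<beta>) * (\<Sum>z | z ^ n = 1 \<and> z \<in> A. root_weight \<beta> z)"
  unfolding measure_def emeasure_nu_measure[OF assms]
  using root_weight_nonneg[OF \<beta> _ n] by (intro enn2real_ennreal mult_nonneg_nonneg sum_nonneg) auto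

text \<open>Grouping the roots by their order \<open>k\<close>: the mass \<open>n powr (- \<beta>) * totient_powr \<beta> k\<close> is spread evenly over the
primitive \<open>k\<close>-th roots.\<close>
lemma measure_nu_measure_orders:
  assumes \<beta>: "\<beta> > 0" and n: "n > 0" and A: "A \<in> sets circle_borel"
  shows "measure (nu_measure \<beta> n) A = real n powr (- \<beta>) *
    (\<Sum>k | k dvd n. totient_powr \<beta> k * (real (card (A \<inter> primitive_roots k)) / real (totient k)))"
proof -
  have "(\<Sum>z | z ^ n = 1 \<and> z \<in> A. root_weight \<beta> z) = (\<Sum>z | z ^ n = 1. if z \<in> A then root_weight \<beta> z else 0)"
    using finite_roots[OF n] by (intro sum.mono_neutral_cong_left) auto
  also have "\<dots> = (\<Sum>k | k dvd n. \<Sum>z\<in>primitive_roots k. if z \<in> A then root_weight \<beta> z else 0)"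
    by (rule sum_roots_unity[OF n])
  also have "\<dots> = (\<Sum>k | k dvd n. totient_powr \<beta> k * (real (card (A \<inter> primitive_roots k)) / real (totient k)))"
  proof (rule sum.cong)
    fix k
    have "(\<Sum>z\<in>primitive_roots k. if z \<in> A then root_weight \<beta> z else 0) =
        (\<Sum>z\<in>A \<inter> primitive_roots k. totient_powr \<beta> k / real (totient k))"
      by (intro sum.mono_neutral_cong_right) (auto simp: primitive_roots_iff root_weight_def)
    then show "(\<Sum>z\<in>primitive_roots k. if z \<in> A then root_weight \<beta> z else 0) =
        totient_powr \<beta> k * (real (card (A \<inter> primitive_roots k)) / real (totient k))" by simp
  qed simp
  finally show ?thesis unfolding measure_nu_measure[OF assms] by simp
qed

lemma primitive_roots_sets [simp]: "primitive_roots k \<in> sets circle_borel"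
  using primitive_roots_subset_circle by (intro circle_borel_countable countable_finite) auto

lemma primitive_roots_disjoint: "j \<noteq> k \<Longrightarrow> primitive_roots j \<inter> primitive_roots k = {}"
  by (auto simp: primitive_roots_iff)

lemma measure_nu_measure_primitive_roots:
  assumes \<beta>: "\<beta> > 0" and n: "n > 0" and k: "k > 0"
  shows "measure (nu_measure \<beta> n) (primitive_roots k) =
    (if k dvd n then real n powr (- \<beta>) * totient_powr \<beta> k else 0)"
proof -
  have "(\<Sum>j | j dvd n. totient_powr \<beta> j * (real (card (primitive_roots k \<inter> primitive_roots j)) / real (totient j))) =
      (\<Sum>j | j dvd n. if j = k then totient_powr \<beta> k else 0)"
    using k by (intro sum.cong refl) (auto simp: card_primitive_roots primitive_roots_disjoint)
  then show ?thesis using n by (simp add: measure_nu_measure_orders[OF \<beta> n] sum.delta)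
qed

lemma circle_prob_nu_measure:
  assumes \<beta>: "\<beta> > 0" and n: "n > 0"
  shows "circle_prob (nu_measure \<beta> n)"
proof -
  have "(\<Sum>z | z ^ n = 1 \<and> z \<in> unit_circle. root_weight \<beta> z) = (\<Sum>z | z ^ n = 1. root_weight \<beta> z)"
    using roots_subset_unit_circle[OF n] by (intro sum.cong) auto
  also have "\<dots> = (\<Sum>k | k dvd n. totient_powr \<beta> k)"
    unfolding sum_roots_unity[OF n] using n
    by (intro sum.cong sum_root_weight_primitive) (auto intro!: Nat.gr0I)
  also have "\<dots> = real n powr \<beta>" by (rule sum_totient_powr_divisors[OF n])
  finally have "emeasure (nu_measure \<beta> n) unit_circle = ennreal (real n powr (- \<beta>) * real n powr \<beta>)"
    using emeasure_nu_measure[OF \<beta> n, of unit_circle] sets.top[of circle_borel] by simp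
  also have "\<dots> = 1" using n by (simp flip: powr_add)
  finally have "prob_space (nu_measure \<beta> n)" by (intro prob_spaceI) simp
  then show ?thesis by (simp add: circle_prob_def)
qed

section \<open>Uniqueness of the coefficients\<close>

lemma summable_on_multiples:
  fixes F :: "nat \<Rightarrow> real"
  assumes "F summable_on {0<..}" "n > 0"
  shows "(\<lambda>d. F (n * d)) summable_on {0<..}"
proof -
  have "F summable_on (*) n ` {0<..}" using assms by (intro summable_on_subset_banach[OF assms(1)]) auto
  then show ?thesis using assms(2) by (subst (asm) summable_on_reindex) (auto simp: o_def inj_on_def)
qed

lemma card_prime_factors_mult_le: "n > 0 \<Longrightarrow> d > 0 \<Longrightarrow> card (prime_factors d) \<le> card (prime_factors (n * d :: nat))"
  by (intro card_mono) (auto simp: prime_factors_product)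

text \<open>Evaluating the series on the primitive \<open>k\<close>-th roots gives
\<open>measure \<nu> (primitive_roots k) / totient_powr \<beta> k = \<Sum>j. (k * j) powr (- \<beta>) * c (k * j)\<close>, and Moebius inversion solves
for \<open>c\<close>.\<close>
lemma convex_series_coefficient:
  assumes \<beta>: "\<beta> > 0" and \<nu>: "circle_prob \<nu>" and c: "is_convex_series \<nu> (nu_measure \<beta>) c" and n: "n > 0"
  shows "((\<lambda>d. of_int (moebius_mu d) * (measure \<nu> (primitive_roots (n * d)) / totient_powr \<beta> (n * d)))
    has_sum real n powr (- \<beta>) * c n) {0<..}"
proof -
  \<comment> \<open>The sequence whose sums over multiples are prescribed.\<close>
  define y where "y m = real m powr (- \<beta>) * c m" for m
  have c0: "c m \<ge> 0" if "m > 0" for m using c that by (simp add: is_convex_series_def)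
  have csum: "c summable_on {0<..}" using c unfolding is_convex_series_def by (auto intro: has_sum_imp_summable)
  have x: "((\<lambda>j. y (k * j)) has_sum measure \<nu> (primitive_roots k) / totient_powr \<beta> k) {0<..}" if k: "k > 0" for k
  proof -
    have "primitive_roots k \<in> sets \<nu>" using circle_probD(2)[OF \<nu>] by simp
    then have "((\<lambda>m. c m * measure (nu_measure \<beta> m) (primitive_roots k)) has_sum measure \<nu> (primitive_roots k)) {0<..}"
      using c unfolding is_convex_series_def by blast
    also have "?this \<longleftrightarrow> ((\<lambda>m. totient_powr \<beta> k * y m) has_sum measure \<nu> (primitive_roots k)) ((*) k ` {0<..})"
      using k
      by (intro has_sum_cong_neutral) (auto simp: measure_nu_measure_primitive_roots[OF \<beta>] y_def elim!: dvdE)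
    also have "\<dots> \<longleftrightarrow> ((\<lambda>j. totient_powr \<beta> k * y (k * j)) has_sum measure \<nu> (primitive_roots k)) {0<..}"
      using k by (subst has_sum_reindex) (auto simp: inj_on_def o_def)
    finally have "((\<lambda>j. 1 / totient_powr \<beta> k * (totient_powr \<beta> k * y (k * j))) has_sum
        1 / totient_powr \<beta> k * measure \<nu> (primitive_roots k)) {0<..}" by (rule has_sum_cmult_right)
    then show ?thesis using totient_powr_pos[OF \<beta> k] by simp
  qed
  have y0: "y m \<ge> 0" if "m > 0" for m using c0[OF that] by (simp add: y_def)
  obtain C where C: "C > 0" "\<And>m. m > 0 \<Longrightarrow> 2 ^ card (prime_factors m) \<le> C * totient_powr \<beta> m"
    using two_power_omega_le_totient_powr[OF \<beta>] by blast
  have "((\<lambda>(m, d). of_int (moebius_mu d) * y (n * (m * d))) has_sum y (n * 1)) ({0<..} \<times> {0<..})"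
  proof (rule moebius_inversion[where G = "\<lambda>m. y (n * m)"])
    show "(\<lambda>m. 2 ^ card (prime_factors m) * y (n * m)) summable_on {0<..}"
    proof (rule summable_on_comparison_test)
      show "(\<lambda>m. C * c (n * m)) summable_on {0<..}"
        by (intro summable_on_cmult_right summable_on_multiples[OF csum n])
      fix m :: nat assume "m \<in> {0<..}"
      then have m: "m > 0" "n * m > 0" using n by auto
      have "2 ^ card (prime_factors m) \<le> (2::real) ^ card (prime_factors (n * m))"
        using card_prime_factors_mult_le[OF n m(1)] by (intro power_increasing) auto
      also have "\<dots> \<le> C * totient_powr \<beta> (n * m)" using C(2)[OF m(2)] .
      also have "\<dots> \<le> C * real (n * m) powr \<beta>" using totient_powr_le[OF \<beta> m(2)] C(1) by (intro mult_left_mono) auto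
      finally have "2 ^ card (prime_factors m) * y (n * m) \<le> C * real (n * m) powr \<beta> * y (n * m)"
        using y0[OF m(2)] by (rule mult_right_mono)
      also have "\<dots> = C * (real (n * m) powr \<beta> * real (n * m) powr (- \<beta>)) * c (n * m)"
        by (simp only: y_def mult_ac)
      also have "real (n * m) powr \<beta> * real (n * m) powr (- \<beta>) = 1" using m(2) by (simp flip: powr_add del: of_nat_mult)
      finally show "2 ^ card (prime_factors m) * y (n * m) \<le> C * c (n * m)" by simp
      show "0 \<le> 2 ^ card (prime_factors m) * y (n * m)" using y0[OF m(2)] by simp
    qed
  qed (use y0 n in auto)
  then have "((\<lambda>(d, m). of_int (moebius_mu d) * y (n * (m * d))) has_sum y n) ({0<..} \<times> {0<..})"
    by (subst (asm) has_sum_swap) (simp add: case_prod_unfold)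
  then have "((\<lambda>d. of_int (moebius_mu d) * (measure \<nu> (primitive_roots (n * d)) / totient_powr \<beta> (n * d)))
      has_sum y n) {0<..}"
  proof (rule has_sum_SigmaD)
    fix d :: nat assume "d \<in> {0<..}"
    then have "((\<lambda>m. y (n * d * m)) has_sum measure \<nu> (primitive_roots (n * d)) / totient_powr \<beta> (n * d)) {0<..}"
      using n by (intro x) auto
    then have "((\<lambda>m. of_int (moebius_mu d) * y (n * d * m)) has_sum
        of_int (moebius_mu d) * (measure \<nu> (primitive_roots (n * d)) / totient_powr \<beta> (n * d))) {0<..}"
      by (rule has_sum_cmult_right)
    then show "((\<lambda>m. case (d, m) of (d, m) \<Rightarrow> of_int (moebius_mu d) * y (n * (m * d))) has_sum
        of_int (moebius_mu d) * (measure \<nu> (primitive_roots (n * d)) / totient_powr \<beta> (n * d))) {0<..}"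
      by (simp add: mult_ac)
  qed
  then show ?thesis by (simp add: y_def)
qed

section \<open>Existence of the expansion\<close>

locale atomic_subconformal_prob =
  fixes \<beta> :: real and \<nu> :: "complex measure"
  assumes \<beta>_pos: "0 < \<beta>" and \<beta>_le_1: "\<beta> \<le> 1"
    and in_atomic_subconformal: "\<nu> \<in> atomic_subconformal_probs \<beta>"
begin

lemma circle: "circle_prob \<nu>" and atomic: "atomic_measure \<nu>" and sub: "subconformal \<beta> \<nu>"
  using in_atomic_subconformal by (auto simp: atomic_subconformal_probs_def)

sublocale prob_space \<nu> using circle_probD(1)[OF circle] .

lemma sub_1: "subconformal 1 \<nu>" using subconformal_mono[OF sub \<beta>_le_1] .

definition order_mass :: "nat \<Rightarrow> real" where "order_mass k = measure \<nu> (primitive_roots k)"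

lemma prim_sets [simp]: "primitive_roots k \<in> sets \<nu>"
  using circle_probD(2)[OF circle] by simp

lemma singleton_sets: "z \<in> primitive_roots k \<Longrightarrow> {z} \<in> sets \<nu>"
  using primitive_roots_subset_circle[of k] by (intro countable_in_sets_circle[OF circle]) blast+

lemma atom_eq:
  assumes u: "u \<in> primitive_roots k"
  shows "measure \<nu> {u} = order_mass k / real (totient k)"
proof -
  have "order_mass k = (\<Sum>z\<in>primitive_roots k. measure \<nu> {z})"
    unfolding order_mass_def by (intro finite_measure_eq_sum_singleton singleton_sets) auto
  also have "\<dots> = (\<Sum>z\<in>primitive_roots k. measure \<nu> {u})"
    using subconformal_atom_le[OF circle sub_1] u by (intro sum.cong antisym) blast+
  also have "\<dots> = real (totient k) * measure \<nu> {u}" by (simp add: card_primitive_roots)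
  finally show ?thesis using u by (simp add: primitive_roots_iff)
qed

lemma measure_inter_primitive_roots:
  "measure \<nu> (A \<inter> primitive_roots k) = order_mass k * (real (card (A \<inter> primitive_roots k)) / real (totient k))"
proof -
  have "measure \<nu> (A \<inter> primitive_roots k) = (\<Sum>z\<in>A \<inter> primitive_roots k. measure \<nu> {z})"
    by (intro finite_measure_eq_sum_singleton singleton_sets[of _ k]) auto
  also have "\<dots> = (\<Sum>z\<in>A \<inter> primitive_roots k. order_mass k / real (totient k))"
    by (intro sum.cong refl atom_eq) blast
  finally show ?thesis by simp
qed

text \<open>An atomic measure is carried by countably many points, and those of infinite order are null.\<close>
lemma AE_finite_order: "AE z in \<nu>. unit_ord z > 0"
proof -
  obtain S where S: "countable S" "AE z in \<nu>. z \<in> S" using atomic by (auto simp: atomic_measure_def)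
  define B where "B = {z \<in> S \<inter> unit_circle. unit_ord z = 0}"
  have "(\<Union>z\<in>B. {z}) \<in> null_sets \<nu>"
  proof (rule null_sets_UN')
    show "countable B" using S(1) by (auto simp: B_def intro: countable_subset)
    fix z assume z: "z \<in> B"
    then have "{z} \<in> sets \<nu>" by (intro countable_in_sets_circle[OF circle]) (auto simp: B_def)
    moreover have "measure \<nu> {z} = 0" using z by (intro subconformal_infinite_order_null[OF circle sub_1]) (auto simp: B_def)
    ultimately show "{z} \<in> null_sets \<nu>" by (simp add: null_sets_def emeasure_eq_measure)
  qed
  then have "B \<in> null_sets \<nu>" by simp
  then have "AE z in \<nu>. z \<notin> B" by (rule AE_not_in)
  moreover have "AE z in \<nu>. z \<in> unit_circle" using circle_probD(3)[OF circle] AE_space[of \<nu>] by simp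
  ultimately show ?thesis using S(2) by eventually_elim (auto simp: B_def)
qed

lemma measure_has_sum_orders:
  assumes A: "A \<in> sets \<nu>"
  shows "((\<lambda>k. measure \<nu> (A \<inter> primitive_roots k)) has_sum measure \<nu> A) {0<..}"
proof -
  have "(\<lambda>k. measure \<nu> (A \<inter> primitive_roots k)) sums measure \<nu> (\<Union>k. A \<inter> primitive_roots k)"
    using A by (intro finite_measure_UNION) (auto simp: disjoint_family_on_def primitive_roots_iff)
  also have "measure \<nu> (\<Union>k. A \<inter> primitive_roots k) = measure \<nu> A"
  proof (rule finite_measure_eq_AE)
    show "AE z in \<nu>. z \<in> (\<Union>k. A \<inter> primitive_roots k) \<longleftrightarrow> z \<in> A"
      using AE_finite_order by eventually_elim (auto simp: primitive_roots_iff)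
    show "(\<Union>k. A \<inter> primitive_roots k) \<in> sets \<nu>"
      using A by (intro sets.countable_UN) auto
  qed (rule A)
  finally have "((\<lambda>k. measure \<nu> (A \<inter> primitive_roots k)) has_sum measure \<nu> A) UNIV"
    by (intro sums_nonneg_imp_has_sum) auto
  then show ?thesis
    by (rule has_sum_cong_neutral[THEN iffD1, rotated -1]) (auto simp: primitive_roots_def)
qed

lemma order_mass_nonneg: "order_mass k \<ge> 0" by (simp add: order_mass_def)

lemma order_mass_summable: "order_mass summable_on {0<..}"
proof -
  have "primitive_roots k \<subseteq> space \<nu>" for k using circle_probD(3)[OF circle] primitive_roots_subset_circle by simp
  then have "(order_mass has_sum measure \<nu> (space \<nu>)) {0<..}"
    using measure_has_sum_orders[OF sets.top] unfolding order_mass_def[abs_def] by (simp add: Int_absorb1)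
  then show ?thesis by (rule has_sum_imp_summable)
qed

text \<open>For \<open>\<nu> = nu_measure \<beta> n\<close> this is \<open>n powr (- \<beta>)\<close> on the divisors of \<open>n\<close> and zero elsewhere, so the expansion of a
general \<open>\<nu>\<close> becomes a sum over multiples.\<close>
definition scaled_mass :: "nat \<Rightarrow> real" where "scaled_mass k = order_mass k / totient_powr \<beta> k"

lemma scaled_mass_nonneg: "k > 0 \<Longrightarrow> scaled_mass k \<ge> 0"
  using totient_powr_pos[OF \<beta>_pos, of k] order_mass_nonneg[of k] by (simp add: scaled_mass_def)

lemma omega_scaled_mass_summable:
  assumes n: "n > 0"
  shows "(\<lambda>m. 2 ^ card (prime_factors m) * scaled_mass (n * m)) summable_on {0<..}"
proof -
  obtain C where C: "C > 0" "\<And>m. m > 0 \<Longrightarrow> 2 ^ card (prime_factors m) \<le> C * totient_powr \<beta> m"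
    using two_power_omega_le_totient_powr[OF \<beta>_pos] by blast
  show ?thesis
  proof (rule summable_on_comparison_test)
    show "(\<lambda>m. C * order_mass (n * m)) summable_on {0<..}"
      by (intro summable_on_cmult_right summable_on_multiples[OF order_mass_summable n])
    fix m :: nat assume "m \<in> {0<..}"
    then have m: "m > 0" "n * m > 0" using n by auto
    have "2 ^ card (prime_factors m) \<le> (2::real) ^ card (prime_factors (n * m))"
      using card_prime_factors_mult_le[OF n m(1)] by (intro power_increasing) auto
    also have "\<dots> \<le> C * totient_powr \<beta> (n * m)" using C(2)[OF m(2)] .
    finally have "2 ^ card (prime_factors m) * scaled_mass (n * m) \<le> C * totient_powr \<beta> (n * m) * scaled_mass (n * m)"
      using scaled_mass_nonneg[OF m(2)] by (rule mult_right_mono)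
    also have "\<dots> = C * order_mass (n * m)" using totient_powr_pos[OF \<beta>_pos m(2)] by (simp add: scaled_mass_def)
    finally show "2 ^ card (prime_factors m) * scaled_mass (n * m) \<le> C * order_mass (n * m)" .
    show "0 \<le> 2 ^ card (prime_factors m) * scaled_mass (n * m)" using scaled_mass_nonneg[OF m(2)] by simp
  qed
qed

lemma moebius_scaled_mass_summable:
  assumes n: "n > 0"
  shows "(\<lambda>d. of_int (moebius_mu d) * scaled_mass (n * d)) summable_on {0<..}"
proof (rule abs_summable_summable, rule summable_on_comparison_test[OF omega_scaled_mass_summable[OF n]])
  fix d :: nat assume "d \<in> {0<..}"
  then have "scaled_mass (n * d) \<ge> 0" using n by (intro scaled_mass_nonneg) auto
  moreover have "\<bar>real_of_int (moebius_mu d)\<bar> \<le> 2 ^ card (prime_factors d)"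
    using moebius_mu_abs_le[of d] one_le_power[of "2::real" "card (prime_factors d)"] by linarith
  ultimately show "norm (of_int (moebius_mu d) * scaled_mass (n * d)) \<le> 2 ^ card (prime_factors d) * scaled_mass (n * d)"
    by (simp add: abs_mult mult_right_mono)
qed simp

lemma measure_power_prime_preimage:
  assumes p: "prime p" and d: "d > 0"
  shows "measure \<nu> (power_preimage (p * d) (primitive_roots k)) =
    measure \<nu> (power_preimage d (primitive_roots (p * k))) +
    (if p dvd k then 0 else measure \<nu> (power_preimage d (primitive_roots k)))"
proof -
  have "power_preimage (p * d) (primitive_roots k) = power_preimage d (primitive_roots (p * k)) \<union>
      (if p dvd k then {} else power_preimage d (primitive_roots k))"
    using power_in_primitive_roots_iff[OF p]
    by (auto simp: power_preimage_def mult.commute[of p d] power_mult)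
  moreover have "power_preimage d (primitive_roots j) \<in> sets \<nu>" for j
    using finite_power_preimage[OF finite_primitive_roots d] power_preimage_subset
    by (intro countable_in_sets_circle[OF circle] countable_finite) auto
  moreover have "power_preimage d (primitive_roots (p * k)) \<inter> power_preimage d (primitive_roots k) = {}"
    using prime_gt_1_nat[OF p] by (auto simp: power_preimage_def primitive_roots_iff)
  ultimately show ?thesis by (simp add: finite_measure_Union)
qed

text \<open>The operator \<open>1 - p powr (- \<beta>) * P p\<close> acts on the masses of the primitive \<open>k\<close>-th roots as
\<open>x k \<mapsto> x k - x (p * k)\<close>, where \<open>x\<close> is \<open>scaled_mass\<close>, up to a factor \<open>1 - p powr (- \<beta>)\<close> in case \<open>p\<close> does not divide \<open>k\<close>. The
factor arises since some preimages of primitive \<open>k\<close>-th roots then have order \<open>k\<close> again.\<close>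
lemma moebius_sum_primitive_preimages:
  assumes n: "n > 0" and k: "k > 0"
  shows "moebius_sum n (\<lambda>d. real d powr (- \<beta>) * measure \<nu> (power_preimage d (primitive_roots k))) =
    totient_powr \<beta> k * (\<Prod>p\<in>{p \<in> prime_factors n. \<not> p dvd k}. 1 - real p powr (- \<beta>)) *
    moebius_sum n (\<lambda>d. scaled_mass (k * d))"
  using n k
proof (induction n arbitrary: k rule: nat_prime_times_induct)
  case one
  then show ?case using totient_powr_pos[OF \<beta>_pos, of k] by (simp add: scaled_mass_def order_mass_def primitive_roots_subset_circle)
next
  case (prime_times p n)
  note p = prime_times(1) and n = prime_times(2) and IH = prime_times.IH and k = prime_times.prems
  have p0: "p > 0" using p prime_gt_0_nat by blast
  define M where "M k = moebius_sum n (\<lambda>d. real d powr (- \<beta>) * measure \<nu> (power_preimage d (primitive_roots k)))" for k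
  define X where "X k = moebius_sum n (\<lambda>d. scaled_mass (k * d))" for k
  define P where "P n k = (\<Prod>q\<in>{q \<in> prime_factors n. \<not> q dvd k}. 1 - real q powr (- \<beta>))" for n k :: nat
  have M: "M j = totient_powr \<beta> j * P n j * X j" if "j > 0" for j
    using IH[OF that] by (simp add: M_def X_def P_def)
  have pf: "prime_factors (p * n) = insert p (prime_factors n)" by (rule prime_factors_prime_times[OF p n])
  show ?case
  proof (cases "p dvd n")
    case True
    then have "p \<in> prime_factors n" using p n by (simp add: prime_factors_dvd)
    then have "prime_factors (p * n) = prime_factors n" unfolding pf by (simp only: insert_absorb)
    then show ?thesis using M[OF k] True
      unfolding M_def X_def P_def by (simp add: moebius_sum_prime_times[OF p n])
  next
    case False
    have pow: "p powr (- \<beta>) * p powr \<beta> = 1" using p0 by (simp flip: powr_add)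
    have "moebius_sum n (\<lambda>d. real (p * d) powr (- \<beta>) * measure \<nu> (power_preimage (p * d) (primitive_roots k))) =
        moebius_sum n (\<lambda>d. real p powr (- \<beta>) * (real d powr (- \<beta>) * measure \<nu> (power_preimage d (primitive_roots (p * k))) +
          (if p dvd k then 0 else 1) * (real d powr (- \<beta>) * measure \<nu> (power_preimage d (primitive_roots k)))))"
    proof (rule moebius_sum_cong)
      fix d assume "d dvd n"
      then have "d > 0" using n by (auto intro!: Nat.gr0I)
      then show "real (p * d) powr (- \<beta>) * measure \<nu> (power_preimage (p * d) (primitive_roots k)) =
          real p powr (- \<beta>) * (real d powr (- \<beta>) * measure \<nu> (power_preimage d (primitive_roots (p * k))) +
          (if p dvd k then 0 else 1) * (real d powr (- \<beta>) * measure \<nu> (power_preimage d (primitive_roots k))))"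
        by (subst measure_power_prime_preimage[OF p]) (simp_all add: powr_mult algebra_simps)
    qed
    also have "\<dots> = real p powr (- \<beta>) * (M (p * k) + (if p dvd k then 0 else 1) * M k)"
      by (simp only: moebius_sum_mult_left moebius_sum_add M_def)
    finally have L: "moebius_sum (p * n) (\<lambda>d. real d powr (- \<beta>) * measure \<nu> (power_preimage d (primitive_roots k))) =
        M k - real p powr (- \<beta>) * (M (p * k) + (if p dvd k then 0 else 1) * M k)"
      using False by (simp add: moebius_sum_prime_times[OF p n] M_def)
    have R: "moebius_sum (p * n) (\<lambda>d. scaled_mass (k * d)) = X k - X (p * k)"
      using False moebius_sum_prime_times[OF p n, of "\<lambda>d. scaled_mass (k * d)"] by (simp add: X_def mult_ac)
    have pn: "p \<notin> prime_factors n" using False by auto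
    have Ppk: "P n (p * k) = P n k"
    proof -
      have "q dvd p * k \<longleftrightarrow> q dvd k" if "q \<in> prime_factors n" for q
      proof -
        have "prime q" "q \<noteq> p" using that pn by auto
        then show ?thesis using p by (metis dvd_mult prime_dvd_mult_iff primes_dvd_imp_eq)
      qed
      then have "{q \<in> prime_factors n. \<not> q dvd p * k} = {q \<in> prime_factors n. \<not> q dvd k}" by blast
      then show ?thesis by (simp only: P_def)
    qed
    have Mpk: "M (p * k) = totient_powr \<beta> (p * k) * P n k * X (p * k)" using M[of "p * k"] p0 k Ppk by simp
    have rec: "totient_powr \<beta> (p * k) = (if p dvd k then real p powr \<beta> else real p powr \<beta> - 1) * totient_powr \<beta> k"
      by (rule totient_powr_prime_times[OF p k])
    have PP: "P (p * n) k = (if p dvd k then 1 else 1 - real p powr (- \<beta>)) * P n k"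
    proof (cases "p dvd k")
      case True
      then have "{q \<in> prime_factors (p * n). \<not> q dvd k} = {q \<in> prime_factors n. \<not> q dvd k}" unfolding pf by blast
      then show ?thesis using True by (simp add: P_def)
    next
      case False
      then have "{q \<in> prime_factors (p * n). \<not> q dvd k} = insert p {q \<in> prime_factors n. \<not> q dvd k}" unfolding pf by blast
      then show ?thesis using False pn by (simp add: P_def)
    qed
    have "M k - real p powr (- \<beta>) * (M (p * k) + (if p dvd k then 0 else 1) * M k) =
        totient_powr \<beta> k * P (p * n) k * (X k - X (p * k))"
    proof (cases "p dvd k")
      case True
      have "real p powr (- \<beta>) * M (p * k) = totient_powr \<beta> k * P n k * X (p * k) * (p powr (- \<beta>) * p powr \<beta>)"
        using True unfolding Mpk rec by simp
      then show ?thesis using True unfolding pow PP M[OF k] by (simp add: algebra_simps)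
    next
      case False
      have "real p powr (- \<beta>) * M (p * k) =
          totient_powr \<beta> k * P n k * X (p * k) * (p powr (- \<beta>) * p powr \<beta> - p powr (- \<beta>))"
        using False unfolding Mpk rec by (simp add: algebra_simps)
      then show ?thesis using False unfolding pow PP M[OF k] by (simp add: algebra_simps)
    qed
    then show ?thesis unfolding L R P_def .
  qed
qed

lemma moebius_sum_scaled_mass_nonneg:
  assumes n: "n > 0" and k: "k > 0"
  shows "moebius_sum n (\<lambda>d. scaled_mass (k * d)) \<ge> 0"
proof -
  have "(\<Prod>p\<in>{p \<in> prime_factors n. \<not> p dvd k}. 1 - real p powr (- \<beta>)) > 0"
  proof (rule prod_pos)
    fix p assume "p \<in> {p \<in> prime_factors n. \<not> p dvd k}"
    then have "real p powr \<beta> > 1" using prime_powr_gt_1 \<beta>_pos by blast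
    then show "1 - real p powr (- \<beta>) > 0" by (simp add: powr_minus inverse_less_1_iff)
  qed
  then have "totient_powr \<beta> k * (\<Prod>p\<in>{p \<in> prime_factors n. \<not> p dvd k}. 1 - real p powr (- \<beta>)) > 0"
    using totient_powr_pos[OF \<beta>_pos k] by simp
  moreover have "moebius_sum n (\<lambda>d. real d powr (- \<beta>) * measure \<nu> (power_preimage d (primitive_roots k))) \<ge> 0"
    by (intro subconformal_finite_set[OF circle sub n]) simp
  ultimately show ?thesis
    unfolding moebius_sum_primitive_preimages[OF n k] by (simp add: zero_le_mult_iff)
qed

text \<open>The coefficient of \<open>nu_measure \<beta> n\<close> divided by \<open>n powr \<beta>\<close>.\<close>
definition series_weight :: "nat \<Rightarrow> real" where
  "series_weight n = (\<Sum>\<^sub>\<infinity>d\<in>{0<..}. of_int (moebius_mu d) * scaled_mass (n * d))"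

lemma series_weight_nonneg: "n > 0 \<Longrightarrow> series_weight n \<ge> 0"
  unfolding series_weight_def by (intro infsum_moebius_nonneg moebius_sum_scaled_mass_nonneg moebius_scaled_mass_summable)

lemma scaled_mass_has_sum_series_weight:
  assumes k: "k > 0"
  shows "((\<lambda>j. series_weight (k * j)) has_sum scaled_mass k) {0<..}"
proof -
  have "((\<lambda>(m, d). of_int (moebius_mu d) * scaled_mass (k * (m * d))) has_sum scaled_mass (k * 1)) ({0<..} \<times> {0<..})"
    using k by (intro moebius_inversion[where G = "\<lambda>m. scaled_mass (k * m)"] omega_scaled_mass_summable scaled_mass_nonneg) auto
  then have "((\<lambda>j. series_weight (k * j)) has_sum scaled_mass (k * 1)) {0<..}"
  proof (rule has_sum_SigmaD)
    fix m :: nat assume "m \<in> {0<..}"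
    then have "((\<lambda>d. of_int (moebius_mu d) * scaled_mass (k * m * d)) has_sum series_weight (k * m)) {0<..}"
      unfolding series_weight_def using k by (intro has_sum_infsum moebius_scaled_mass_summable) auto
    then show "((\<lambda>d. case (m, d) of (m, d) \<Rightarrow> of_int (moebius_mu d) * scaled_mass (k * (m * d))) has_sum series_weight (k * m)) {0<..}"
      by (simp add: mult_ac)
  qed
  then show ?thesis by simp
qed

lemma convex_series_series_weight: "is_convex_series \<nu> (nu_measure \<beta>) (\<lambda>n. real n powr \<beta> * series_weight n)"
proof -
  have series: "((\<lambda>n. real n powr \<beta> * series_weight n * measure (nu_measure \<beta> n) A) has_sum measure \<nu> A) {0<..}"
    if A: "A \<in> sets \<nu>" for A
  proof -
    define c where "c k = real (card (A \<inter> primitive_roots k)) / real (totient k)" for k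
    \<comment> \<open>Summation over the order k first gives the measure of A; grouping by n = k * j gives the series.\<close>
    define f where "f = (\<lambda>(k, j). totient_powr \<beta> k * c k * series_weight (k * j))"
    define g where "g = (\<lambda>(n, k). totient_powr \<beta> k * c k * series_weight n)"
    have c0: "c k \<ge> 0" for k by (simp add: c_def)
    have inner: "((\<lambda>j. f (k, j)) has_sum measure \<nu> (A \<inter> primitive_roots k)) {0<..}" if "k \<in> {0<..}" for k
    proof -
      have "((\<lambda>j. f (k, j)) has_sum totient_powr \<beta> k * c k * scaled_mass k) {0<..}"
        unfolding f_def split using that by (intro has_sum_cmult_right scaled_mass_has_sum_series_weight) auto
      then show ?thesis
        using that totient_powr_pos[OF \<beta>_pos, of k] by (simp add: measure_inter_primitive_roots c_def scaled_mass_def mult_ac)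
    qed
    have "(f has_sum measure \<nu> A) ({0<..} \<times> {0<..})"
    proof (rule has_sum_SigmaI[OF inner measure_has_sum_orders[OF A]])
      show "f summable_on {0<..} \<times> {0<..}"
        by (rule summable_on_SigmaI[OF inner has_sum_imp_summable[OF measure_has_sum_orders[OF A]]])
           (auto simp: f_def intro!: mult_nonneg_nonneg c0 series_weight_nonneg less_imp_le[OF totient_powr_pos[OF \<beta>_pos]])
    qed
    also have "?this \<longleftrightarrow> (g has_sum measure \<nu> A) (Sigma {0<..} (\<lambda>n. {k. k dvd n}))"
      by (rule has_sum_reindex_bij_witness[of _ "\<lambda>(n, k). (k, n div k)" "\<lambda>(k, j). (k * j, k)"])
         (auto simp: f_def g_def intro!: Nat.gr0I elim!: dvdE)
    finally show ?thesis
    proof (rule has_sum_SigmaD)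
      fix n :: nat assume "n \<in> {0<..}"
      then have n: "n > 0" by simp
      have "real n powr \<beta> * series_weight n * measure (nu_measure \<beta> n) A =
          (real n powr \<beta> * real n powr (- \<beta>)) * (series_weight n * (\<Sum>k | k dvd n. totient_powr \<beta> k * c k))"
        using A circle_probD(2)[OF circle] by (simp add: measure_nu_measure_orders[OF \<beta>_pos n] c_def)
      also have "real n powr \<beta> * real n powr (- \<beta>) = 1" using n by (simp flip: powr_add)
      finally show "((\<lambda>k. g (n, k)) has_sum real n powr \<beta> * series_weight n * measure (nu_measure \<beta> n) A) {k. k dvd n}"
        using n by (intro has_sum_finiteI) (auto simp: g_def sum_distrib_left mult_ac)
    qed
  qed
  have "((\<lambda>n. real n powr \<beta> * series_weight n) has_sum 1) {0<..}"
  proof -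
    have "((\<lambda>n. real n powr \<beta> * series_weight n * measure (nu_measure \<beta> n) (space \<nu>)) has_sum measure \<nu> (space \<nu>)) {0<..}"
      by (rule series) simp
    also have "measure \<nu> (space \<nu>) = 1" by (rule prob_space)
    finally show ?thesis
    proof (rule has_sum_cong[THEN iffD1, rotated])
      fix n :: nat assume "n \<in> {0<..}"
      then interpret n: prob_space "nu_measure \<beta> n"
        using circle_probD(1)[OF circle_prob_nu_measure[OF \<beta>_pos]] by simp
      show "real n powr \<beta> * series_weight n * measure (nu_measure \<beta> n) (space \<nu>) = real n powr \<beta> * series_weight n"
        using n.prob_space circle_probD(3)[OF circle] by simp
    qed
  qed
  then show ?thesis using series series_weight_nonneg by (simp add: is_convex_series_def)
qed

end

section \<open>Subconformality of \<open>nu_measure \<beta> n\<close>\<close>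

lemma integral_nu_measure:
  fixes f :: "complex \<Rightarrow> real"
  assumes \<beta>: "\<beta> > 0" and n: "n > 0" and f: "continuous_on unit_circle f"
  shows "(\<integral>z. f z \<partial>nu_measure \<beta> n) = real n powr (- \<beta>) * (\<Sum>z | z ^ n = 1. root_weight \<beta> z * f z)"
proof -
  define w where "w z = real n powr (- \<beta>) * root_weight \<beta> z" for z
  have w: "w z \<ge> 0" if "z ^ n = 1" for z using root_weight_nonneg[OF \<beta> that n] by (simp add: w_def)
  have fm: "f \<in> borel_measurable circle_borel"
    unfolding circle_borel_def using f by (rule borel_measurable_continuous_on_restrict)
  have "(\<integral>z. f z \<partial>nu_measure \<beta> n) = (\<integral>z. f z \<partial>point_measure {z. z ^ n = 1} w)"
    unfolding nu_measure_def w_def root_weight_def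
    by (rule integral_distr[OF measurable_nu_measure_id[OF n] fm])
  also have "\<dots> = (\<Sum>z | z ^ n = 1. w z * f z)"
    using finite_roots[OF n] w by (subst lebesgue_integral_point_measure_finite) auto
  finally show ?thesis by (simp add: w_def sum_distrib_left mult_ac)
qed

text \<open>Push-forward along \<open>z \<mapsto> z ^ p\<close>. If \<open>p\<close> does not divide \<open>n\<close>, the map permutes the \<open>n\<close>-th roots and preserves orders. Otherwise it
maps onto the \<open>(n div p)\<close>-th roots, and the weights of a fibre add up by
\<open>sum_root_weight_prime_preimage\<close>.\<close>
lemma integral_nu_measure_prime_power:
  fixes f :: "complex \<Rightarrow> real"
  assumes \<beta>: "\<beta> > 0" and n: "n > 0" and p: "prime p" and f: "continuous_on unit_circle f"
  shows "(\<integral>z. f (z ^ p) \<partial>nu_measure \<beta> n) = (\<integral>z. f z \<partial>nu_measure \<beta> (n div gcd n p))"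
proof -
  have p0: "p > 0" using p prime_gt_0_nat by blast
  note L = integral_nu_measure[OF \<beta> n continuous_on_circle_power[OF f]]
  show ?thesis
  proof (cases "p dvd n")
    case False
    then have cop: "coprime p n" using p prime_imp_coprime by blast
    have "(\<lambda>z. z ^ p) ` {z. z ^ n = 1} = {z::complex. z ^ n = 1}"
    proof (rule endo_inj_surj[OF finite_roots[OF n] _ inj_on_coprime_power[OF n cop]])
      show "(\<lambda>z. z ^ p) ` {z. z ^ n = 1} \<subseteq> {z::complex. z ^ n = 1}"
        by (auto simp: mult.commute[of p] power_mult simp flip: power_mult[of _ p n])
    qed
    then have "bij_betw (\<lambda>z. z ^ p) {z. z ^ n = 1} {z::complex. z ^ n = 1}"
      using inj_on_coprime_power[OF n cop] by (simp add: bij_betw_def)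
    then have "(\<Sum>z | z ^ n = 1. root_weight \<beta> z * f z) = (\<Sum>z | z ^ n = 1. root_weight \<beta> (z ^ p) * f (z ^ p))"
      by (rule sum.reindex_bij_betw[symmetric])
    also have "\<dots> = (\<Sum>z | z ^ n = 1. root_weight \<beta> z * f (z ^ p))"
    proof (rule sum.cong)
      fix z :: complex assume "z \<in> {z. z ^ n = 1}"
      then have "unit_ord z dvd n" by (simp add: power_eq_1_iff_unit_ord_dvd)
      then have "coprime (unit_ord z) p" "unit_ord z > 0"
        using cop n by (auto intro: coprime_divisors[of _ n _ p] simp: coprime_commute intro!: Nat.gr0I)
      then show "root_weight \<beta> (z ^ p) * f (z ^ p) = root_weight \<beta> z * f (z ^ p)"
        by (simp add: root_weight_def unit_ord_power_coprime)
    qed simp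
    finally have "(\<integral>z. f (z ^ p) \<partial>nu_measure \<beta> n) = (\<integral>z. f z \<partial>nu_measure \<beta> n)"
      unfolding L integral_nu_measure[OF \<beta> n f] by simp
    moreover have "gcd n p = 1" using cop by (metis coprime_iff_gcd_eq_1 gcd.commute)
    ultimately show ?thesis by simp
  next
    case True
    then obtain j where j: "n = p * j" by blast
    have j0: "j > 0" using n j by simp
    have fin: "finite {z::complex. z ^ p = u}" for u using p0 finite_nth_roots by blast
    have "{z::complex. z ^ n = 1} = (\<Union>u\<in>{u. u ^ j = 1}. {z. z ^ p = u})" by (auto simp: j power_mult)
    then have "(\<Sum>z | z ^ n = 1. root_weight \<beta> z * f (z ^ p)) =
        (\<Sum>z\<in>(\<Union>u\<in>{u. u ^ j = 1}. {z. z ^ p = u}). root_weight \<beta> z * f (z ^ p))" by simp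
    also have "\<dots> = (\<Sum>u | u ^ j = 1. \<Sum>z | z ^ p = u. root_weight \<beta> z * f (z ^ p))"
      using finite_roots[OF j0] fin by (intro sum.UNION_disjoint) auto
    also have "\<dots> = (\<Sum>u | u ^ j = 1. real p powr \<beta> * (root_weight \<beta> u * f u))"
    proof (rule sum.cong)
      fix u :: complex assume "u \<in> {u. u ^ j = 1}"
      then have "unit_ord u > 0" using j0 by (auto simp: unit_ord_pos_iff)
      have "(\<Sum>z | z ^ p = u. root_weight \<beta> z * f (z ^ p)) = (\<Sum>z | z ^ p = u. root_weight \<beta> z) * f u"
        unfolding sum_distrib_right by (intro sum.cong) auto
      then show "(\<Sum>z | z ^ p = u. root_weight \<beta> z * f (z ^ p)) = real p powr \<beta> * (root_weight \<beta> u * f u)"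
        by (simp only: sum_root_weight_prime_preimage[OF p \<open>unit_ord u > 0\<close>] mult.assoc)
    qed simp
    also have "\<dots> = real p powr \<beta> * (\<Sum>u | u ^ j = 1. root_weight \<beta> u * f u)"
      by (simp add: sum_distrib_left)
    finally have "(\<integral>z. f (z ^ p) \<partial>nu_measure \<beta> n) =
        (real n powr (- \<beta>) * real p powr \<beta>) * (\<Sum>u | u ^ j = 1. root_weight \<beta> u * f u)"
      unfolding L by simp
    also have "real n powr (- \<beta>) * real p powr \<beta> = real j powr (- \<beta>)"
      using p0 by (simp add: j powr_mult powr_minus)
    also have "real j powr (- \<beta>) * (\<Sum>u | u ^ j = 1. root_weight \<beta> u * f u) = (\<integral>z. f z \<partial>nu_measure \<beta> j)"
      by (rule integral_nu_measure[OF \<beta> j0 f, symmetric])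
    finally show ?thesis using p0 by (simp add: j)
  qed
qed

lemma integral_nu_measure_power:
  fixes f :: "complex \<Rightarrow> real"
  assumes \<beta>: "\<beta> > 0" and n: "n > 0" and d: "d > 0" and f: "continuous_on unit_circle f"
  shows "(\<integral>z. f (z ^ d) \<partial>nu_measure \<beta> n) = (\<integral>z. f z \<partial>nu_measure \<beta> (n div gcd n d))"
  using d n f
proof (induction d arbitrary: n f rule: nat_prime_times_induct)
  case (prime_times p d)
  define j where "j = n div gcd n p"
  have g0: "gcd n p > 0" using prime_times by simp
  have j: "n = gcd n p * j" by (simp add: j_def)
  have j0: "j > 0" using prime_times.prems(1) j by (metis gr0I mult_0_right)
  have gcd: "gcd n (p * d) = gcd n p * gcd j d"
  proof (cases "p dvd n")
    case True
    then have "gcd n p = p" by (simp add: gcd_nat.absorb2)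
    then show ?thesis using j by (metis gcd_mult_distrib_nat)
  next
    case False
    then have cop: "coprime n p" using prime_times(1) prime_imp_coprime coprime_commute by blast
    then have "gcd n p = 1" by simp
    then show ?thesis using cop j by (simp add: gcd_mult_right_left_cancel)
  qed
  have "(\<integral>z. f (z ^ (p * d)) \<partial>nu_measure \<beta> n) = (\<integral>z. (\<lambda>z. f (z ^ d)) (z ^ p) \<partial>nu_measure \<beta> n)"
    by (simp add: power_mult)
  also have "\<dots> = (\<integral>z. f (z ^ d) \<partial>nu_measure \<beta> j)"
    unfolding j_def using prime_times.prems
    by (intro integral_nu_measure_prime_power[OF \<beta> _ prime_times(1)] continuous_on_circle_power)
  also have "\<dots> = (\<integral>z. f z \<partial>nu_measure \<beta> (j div gcd j d))"
    using prime_times.IH[OF j0 prime_times.prems(2)] .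
  also have "j div gcd j d = n div gcd n (p * d)"
    unfolding gcd using g0 by (subst j) (simp only: div_mult_mult1)
  finally show ?case .
qed simp

text \<open>By \<open>integral_nu_measure_power\<close>, each integral is a sum over the orders \<open>k dvd n\<close>, weighted by the non-negative
integral of \<open>f\<close> over the primitive \<open>k\<close>-th roots. The remaining dependence on \<open>d\<close> is
the function \<open>h k\<close>, which is multiplicative on squarefree numbers with values between \<open>0\<close> and \<open>1\<close> at primes; its Moebius sum is
therefore a product of non-negative factors.\<close>
lemma subconformal_nu_measure:
  assumes \<beta>: "\<beta> > 0" and n: "n > 0"
  shows "subconformal \<beta> (nu_measure \<beta> n)"
  unfolding subconformal_iff
proof (intro allI impI)
  fix f :: "complex \<Rightarrow> real" and m :: nat
  assume m: "m > 0" and f: "continuous_on unit_circle f" "\<forall>z\<in>unit_circle. f z \<ge> 0"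
  define \<Phi> where "\<Phi> k = (\<Sum>z\<in>primitive_roots k. root_weight \<beta> z * f z)" for k
  have \<Phi>: "\<Phi> k \<ge> 0" for k
    unfolding \<Phi>_def
  proof (intro sum_nonneg mult_nonneg_nonneg)
    fix z assume z: "z \<in> primitive_roots k"
    then show "root_weight \<beta> z \<ge> 0" using root_weight_pos[OF \<beta>, of z] by (simp add: primitive_roots_iff)
    show "f z \<ge> 0" using f(2) z primitive_roots_subset_circle by blast
  qed
  \<comment> \<open>The condition in h expresses that k divides n div gcd n d.\<close>
  define h where "h k d = (real (gcd n d) / real d) powr \<beta> * of_bool (gcd n d dvd n div k)" for k d
  have int: "real d powr (- \<beta>) * (\<integral>z. f (z ^ d) \<partial>nu_measure \<beta> n) =
      (\<Sum>k | k dvd n. real n powr (- \<beta>) * \<Phi> k * h k d)" if d: "d > 0" for d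
  proof -
    define g where "g = gcd n d"
    have g: "g > 0" "g dvd n" using n by (auto simp: g_def)
    define j where "j = n div g"
    have nj: "n = g * j" using g by (simp add: j_def)
    have j0: "j > 0" using n nj by simp
    have "(\<integral>z. f (z ^ d) \<partial>nu_measure \<beta> n) = real j powr (- \<beta>) * (\<Sum>k | k dvd j. \<Phi> k)"
      unfolding integral_nu_measure_power[OF \<beta> n d f(1)] \<Phi>_def g_def[symmetric] j_def[symmetric]
      by (simp only: integral_nu_measure[OF \<beta> j0 f(1)] sum_roots_unity[OF j0])
    also have "(\<Sum>k | k dvd j. \<Phi> k) = (\<Sum>k | k dvd n. \<Phi> k * of_bool (g dvd n div k))"
    proof -
      have "k dvd j \<longleftrightarrow> k dvd n \<and> g dvd n div k" if "k > 0" for k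
      proof
        assume "k dvd j"
        then obtain i where "j = k * i" by blast
        then show "k dvd n \<and> g dvd n div k" using that by (auto simp: nj)
      next
        assume *: "k dvd n \<and> g dvd n div k"
        then obtain i where "n div k = g * i" by blast
        moreover have "n = k * (n div k)" using * by simp
        ultimately have "g * j = g * (k * i)" using nj by (simp add: mult_ac)
        then show "k dvd j" using g by simp
      qed
      then have "{k. k dvd j} = {k \<in> {k. k dvd n}. g dvd n div k}"
        using n j0 by (auto intro!: Nat.gr0I) (metis dvd_0_left_iff gr0I)+
      then have "(\<Sum>k | k dvd j. \<Phi> k) = (\<Sum>k\<in>{k \<in> {k. k dvd n}. g dvd n div k}. \<Phi> k)" by simp
      also have "\<dots> = (\<Sum>k | k dvd n. if g dvd n div k then \<Phi> k else 0)"
        using n by (intro sum.inter_filter) simp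
      also have "\<dots> = (\<Sum>k | k dvd n. \<Phi> k * of_bool (g dvd n div k))" by (intro sum.cong) auto
      finally show ?thesis .
    qed
    also have "real j powr (- \<beta>) = real n powr (- \<beta>) * real g powr \<beta>"
      using g j0 by (simp add: nj powr_mult powr_minus)
    finally have "real d powr (- \<beta>) * (\<integral>z. f (z ^ d) \<partial>nu_measure \<beta> n) =
        real n powr (- \<beta>) * (real g powr \<beta> * real d powr (- \<beta>)) * (\<Sum>k | k dvd n. \<Phi> k * of_bool (g dvd n div k))"
      by simp
    also have "real g powr \<beta> * real d powr (- \<beta>) = (real g / real d) powr \<beta>"
      by (simp add: powr_divide powr_minus_divide)
    finally show ?thesis by (simp add: h_def g_def sum_distrib_left mult_ac)
  qed
  have "moebius_sum m (h k) \<ge> 0" if k: "k dvd n" for k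
  proof -
    have "moebius_sum m (h k) = (\<Prod>p\<in>prime_factors m. 1 - h k p)"
    proof (rule moebius_sum_multiplicative[OF m])
      show "h k 1 = 1" by (simp add: h_def)
      fix p d :: nat assume p: "prime p" and d: "d > 0" "\<not> p dvd d"
      have cop: "coprime p d" using p d prime_imp_coprime by blast
      have gcd: "gcd n (p * d) = gcd n p * gcd n d"
      proof (cases "p dvd n")
        case True
        then obtain i where i: "n = p * i" by blast
        have "coprime d p" using cop by (rule coprime_commute[THEN iffD1])
        then have "gcd n d = gcd i d" unfolding i by (rule gcd_mult_left_left_cancel)
        moreover have "gcd n p = p" using True by (simp add: gcd_nat.absorb2)
        moreover have "gcd n (p * d) = p * gcd i d" by (simp add: i gcd_mult_distrib_nat)
        ultimately show ?thesis by simp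
      next
        case False
        then have cop: "coprime n p" using p prime_imp_coprime coprime_commute by blast
        then show ?thesis by (simp add: gcd_mult_right_left_cancel)
      qed
      have "coprime (gcd n p) (gcd n d)" using cop by (rule coprime_divisors[rotated 2]) auto
      then have "gcd n (p * d) dvd n div k \<longleftrightarrow> gcd n p dvd n div k \<and> gcd n d dvd n div k"
        unfolding gcd by (auto intro: divides_mult dvd_mult_left dvd_mult_right)
      then show "h k (p * d) = h k p * h k d"
        by (auto simp: h_def gcd powr_mult powr_divide)
    qed
    also have "\<dots> \<ge> 0"
    proof (rule prod_nonneg)
      fix p assume "p \<in> prime_factors m"
      then have p: "p > 0" using prime_gt_0_nat by auto
      then have "gcd n p \<le> p" by (simp add: gcd_le2_nat)
      then have "(real (gcd n p) / real p) powr \<beta> \<le> 1 powr \<beta>" using p \<beta> by (intro powr_mono2) auto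
      then show "0 \<le> 1 - h k p" by (simp add: h_def)
    qed
    finally show ?thesis .
  qed
  moreover have "moebius_sum m (\<lambda>d. real d powr (- \<beta>) * (\<integral>z. f (z ^ d) \<partial>nu_measure \<beta> n)) =
      (\<Sum>k | k dvd n. real n powr (- \<beta>) * \<Phi> k * moebius_sum m (h k))"
  proof -
    have "moebius_sum m (\<lambda>d. real d powr (- \<beta>) * (\<integral>z. f (z ^ d) \<partial>nu_measure \<beta> n)) =
        moebius_sum m (\<lambda>d. \<Sum>k | k dvd n. real n powr (- \<beta>) * \<Phi> k * h k d)"
      using m by (intro moebius_sum_cong int) (auto intro!: Nat.gr0I)
    also have "\<dots> = (\<Sum>k | k dvd n. moebius_sum m (\<lambda>d. real n powr (- \<beta>) * \<Phi> k * h k d))"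
      unfolding moebius_sum_def sum_distrib_left by (rule sum.swap)
    finally show ?thesis by (simp only: moebius_sum_mult_left)
  qed
  ultimately show "moebius_sum m (\<lambda>d. real d powr (- \<beta>) * (\<integral>z. f (z ^ d) \<partial>nu_measure \<beta> n)) \<ge> 0"
    using \<Phi> by (auto intro!: sum_nonneg mult_nonneg_nonneg)
qed

lemma nu_measure_in_atomic_subconformal:
  assumes \<beta>: "\<beta> > 0" and n: "n > 0"
  shows "nu_measure \<beta> n \<in> atomic_subconformal_probs \<beta>"
proof -
  interpret prob_space "nu_measure \<beta> n" using circle_probD(1)[OF circle_prob_nu_measure[OF \<beta> n]] .
  have R: "{z. z ^ n = 1} \<in> sets circle_borel"
    using finite_roots[OF n] roots_subset_unit_circle[OF n] by (intro circle_borel_countable countable_finite)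
  have "prob {z. z ^ n = 1} = prob unit_circle"
    unfolding measure_nu_measure[OF \<beta> n R] using measure_nu_measure[OF \<beta> n, of unit_circle]
      sets.top[of circle_borel] roots_subset_unit_circle[OF n]
    by (auto intro!: arg_cong2[where f = "(*)"] sum.cong)
  then have "prob {z. z ^ n = 1} = 1" using prob_space by simp
  then have "AE z in nu_measure \<beta> n. z \<in> {z. z ^ n = 1}" using R by (subst (asm) prob_eq_1) auto
  then have "atomic_measure (nu_measure \<beta> n)"
    unfolding atomic_measure_def using countable_finite[OF finite_roots[OF n]] by blast
  then show ?thesis
    using circle_prob_nu_measure[OF \<beta> n] subconformal_nu_measure[OF \<beta> n]
    by (simp add: atomic_subconformal_probs_def)
qed

section \<open>Mixtures and extreme points\<close>

lemma circle_prob_eqI: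
  assumes "circle_prob \<mu>" "circle_prob \<nu>" "\<And>A. A \<in> sets \<nu> \<Longrightarrow> measure \<mu> A = measure \<nu> A"
  shows "\<mu> = \<nu>"
proof (rule measure_eqI)
  interpret \<mu>: prob_space \<mu> using circle_probD(1)[OF assms(1)] .
  interpret \<nu>: prob_space \<nu> using circle_probD(1)[OF assms(2)] .
  show sets: "sets \<mu> = sets \<nu>" using circle_probD(2) assms by blast
  fix A assume "A \<in> sets \<mu>"
  then show "emeasure \<mu> A = emeasure \<nu> A"
    using assms(3) sets by (simp add: \<mu>.emeasure_eq_measure \<nu>.emeasure_eq_measure)
qed

lemma sums_imp_pmf:
  fixes c :: "nat \<Rightarrow> real"
  assumes "\<And>n. c n \<ge> 0" "c sums 1"
  obtains p where "pmf p = c"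
proof -
  have "(\<integral>\<^sup>+n. ennreal (c n) \<partial>count_space UNIV) = 1"
    using suminf_ennreal_eq[OF assms] by (simp add: nn_integral_count_space_nat)
  then have "pmf (embed_pmf c) = c" using pmf_embed_pmf[of c] assms(1) by auto
  then show ?thesis using that by blast
qed

text \<open>The mixture is built as a monadic bind of the probability mass function \<open>c\<close> with the kernel \<open>nu_measure \<beta>\<close>. Integrals
of bounded non-negative functions mix accordingly, which transfers subconformality.\<close>
lemma nu_mixture:
  assumes \<beta>: "\<beta> > 0" and c0: "\<And>n. n > 0 \<Longrightarrow> c n \<ge> 0" and c1: "(c has_sum 1) {0<..}"
  obtains \<rho> where "\<rho> \<in> atomic_subconformal_probs \<beta>" "is_convex_series \<rho> (nu_measure \<beta>) c"
proof -
  define c' where "c' n = (if n = 0 then 0 else c n)" for n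
  have c'0: "c' n \<ge> 0" for n using c0 by (simp add: c'_def)
  have "(c' has_sum 1) UNIV"
    using c1 by (rule has_sum_cong_neutral[THEN iffD1, rotated -1]) (auto simp: c'_def)
  then have c'1: "c' sums 1" by (rule has_sum_imp_sums)
  obtain p where p: "pmf p = c'" using sums_imp_pmf[OF c'0 c'1] by blast
  \<comment> \<open>The index 0 carries no mass; any probability measure serves there to make K a probability kernel.\<close>
  define K where "K n = nu_measure \<beta> (if n = 0 then 1 else n)" for n
  have K: "circle_prob (K n)" for n unfolding K_def by (intro circle_prob_nu_measure[OF \<beta>]) auto
  have Km: "K \<in> measure_pmf p \<rightarrow>\<^sub>M prob_algebra circle_borel"
    using K by (auto simp: space_prob_algebra circle_prob_def)
  have Ks: "K \<in> measure_pmf p \<rightarrow>\<^sub>M subprob_algebra circle_borel" using Km by (rule measurable_prob_algebraD)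
  define \<rho> where "\<rho> = measure_pmf p \<bind> K"
  have pa: "measure_pmf p \<in> space (prob_algebra (count_space UNIV))"
    by (simp add: space_prob_algebra measure_pmf.prob_space_axioms)
  have Km': "K \<in> count_space UNIV \<rightarrow>\<^sub>M prob_algebra circle_borel"
    using K by (auto simp: space_prob_algebra circle_prob_def)
  have \<rho>: "circle_prob \<rho>"
    unfolding circle_prob_def \<rho>_def using prob_space_bind'[OF pa Km'] sets_bind'[OF pa Km'] by blast
  interpret \<rho>: prob_space \<rho> using circle_probD(1)[OF \<rho>] .
  have int: "((\<lambda>n. c n * (\<integral>z. f z \<partial>nu_measure \<beta> n)) has_sum (\<integral>z. f z \<partial>\<rho>)) {0<..}"
    if f: "f \<in> borel_measurable circle_borel" "\<And>z. z \<in> unit_circle \<Longrightarrow> 0 \<le> f z" "\<And>z. z \<in> unit_circle \<Longrightarrow> f z \<le> B"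
    for f :: "complex \<Rightarrow> real" and B
  proof -
    have fm: "f \<in> borel_measurable \<mu>" if "circle_prob \<mu>" for \<mu>
      using f(1) measurable_cong_sets[OF circle_probD(2)[OF that] refl] by blast
    have fi: "integrable \<mu> f" "(\<integral>z. f z \<partial>\<mu>) \<ge> 0" "(\<integral>z. f z \<partial>\<mu>) \<le> B"
        "(\<integral>\<^sup>+z. ennreal (f z) \<partial>\<mu>) = ennreal (\<integral>z. f z \<partial>\<mu>)" if \<mu>: "circle_prob \<mu>" for \<mu>
    proof -
      interpret \<mu>: prob_space \<mu> using circle_probD(1)[OF \<mu>] .
      have f': "0 \<le> f z" "f z \<le> B" if "z \<in> space \<mu>" for z using f that circle_probD(3)[OF \<mu>] by auto
      show int: "integrable \<mu> f"
        using f' by (intro \<mu>.integrable_const_bound[of _ B] fm[OF \<mu>] AE_I2) (simp add: abs_le_iff)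
      show "(\<integral>z. f z \<partial>\<mu>) \<ge> 0" using f' by (intro integral_nonneg_AE AE_I2)
      have "(\<integral>z. f z \<partial>\<mu>) \<le> (\<integral>z. B \<partial>\<mu>)" using f' by (intro integral_mono int) auto
      then show "(\<integral>z. f z \<partial>\<mu>) \<le> B" using \<mu>.prob_space by simp
      show "(\<integral>\<^sup>+z. ennreal (f z) \<partial>\<mu>) = ennreal (\<integral>z. f z \<partial>\<mu>)"
        using f' by (intro nn_integral_eq_integral int AE_I2)
    qed
    define I where "I n = (\<integral>z. f z \<partial>K n)" for n
    have I: "0 \<le> I n" "I n \<le> B" for n using fi(2,3)[OF K] by (auto simp: I_def)
    have "summable (\<lambda>n. c' n * I n)"
    proof (rule summable_comparison_test')
      show "summable (\<lambda>n. c' n * B)" using c'1 by (intro summable_mult2) (rule sums_summable)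
      show "norm (c' n * I n) \<le> c' n * B" for n using I[of n] c'0[of n] by (simp add: mult_left_mono)
    qed
    then have S: "(\<lambda>n. c' n * I n) sums (\<Sum>n. c' n * I n)" by (rule summable_sums)
    have "ennreal (\<integral>z. f z \<partial>\<rho>) = (\<integral>\<^sup>+z. ennreal (f z) \<partial>\<rho>)" using fi(4)[OF \<rho>] by simp
    also have "\<dots> = (\<integral>\<^sup>+n. \<integral>\<^sup>+z. ennreal (f z) \<partial>K n \<partial>measure_pmf p)"
      unfolding \<rho>_def using f(1) by (intro nn_integral_bind[OF _ Ks]) measurable
    also have "\<dots> = (\<integral>\<^sup>+n. ennreal (I n) \<partial>measure_pmf p)" using fi(4)[OF K] by (simp add: I_def)
    also have "\<dots> = (\<integral>\<^sup>+n. ennreal (c' n) * ennreal (I n) \<partial>count_space UNIV)"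
      unfolding measure_pmf_eq_density p by (subst nn_integral_density) auto
    also have "\<dots> = (\<Sum>n. ennreal (c' n * I n))"
      using c'0 I by (simp add: nn_integral_count_space_nat ennreal_mult)
    also have "\<dots> = ennreal (\<Sum>n. c' n * I n)" using c'0 I by (intro suminf_ennreal_eq S) auto
    finally have "(\<integral>z. f z \<partial>\<rho>) = (\<Sum>n. c' n * I n)"
      using fi(2)[OF \<rho>] suminf_nonneg[OF sums_summable[OF S]] c'0 I by simp
    then have "((\<lambda>n. c' n * I n) has_sum (\<integral>z. f z \<partial>\<rho>)) UNIV"
      using S c'0 I by (intro sums_nonneg_imp_has_sum) auto
    then show ?thesis
      by (rule has_sum_cong_neutral[THEN iffD1, rotated -1]) (auto simp: c'_def I_def K_def)
  qed
  have series: "is_convex_series \<rho> (nu_measure \<beta>) c"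
    unfolding is_convex_series_def
  proof (intro conjI allI impI ballI c0 c1)
    fix A assume A: "A \<in> sets \<rho>"
    then have A': "A \<in> sets circle_borel" using circle_probD(2)[OF \<rho>] by simp
    have meas: "(\<integral>z. indicator A z \<partial>\<mu>) = measure \<mu> A" if "circle_prob \<mu>" for \<mu>
    proof -
      have "A \<in> sets \<mu>" using A' circle_probD(2)[OF that] by simp
      then show ?thesis by simp
    qed
    have "((\<lambda>n. c n * (\<integral>z. indicator A z \<partial>nu_measure \<beta> n)) has_sum (\<integral>z. indicator A z \<partial>\<rho>)) {0<..}"
      using A' by (intro int[of _ 1]) auto
    then show "((\<lambda>n. c n * measure (nu_measure \<beta> n) A) has_sum measure \<rho> A) {0<..}"
      unfolding meas[OF \<rho>]
      by (rule has_sum_cong[THEN iffD1, rotated]) (simp only: meas[OF circle_prob_nu_measure[OF \<beta>]] greaterThan_iff)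
  qed
  have "atomic_measure \<rho>"
  proof -
    define S where "S = (\<Union>n\<in>{0<..}. {z::complex. z ^ n = 1})"
    have S: "countable S"
      unfolding S_def
    proof (rule countable_UN)
      show "countable {z::complex. z ^ n = 1}" if "n \<in> {0<..}" for n
        using that by (intro countable_finite finite_roots) auto
    qed simp
    have Ssub: "S \<subseteq> unit_circle" unfolding S_def using roots_subset_unit_circle by blast
    have Scb: "S \<in> sets circle_borel" using circle_borel_countable[OF S Ssub] .
    have "measure (nu_measure \<beta> n) S = 1" if n: "n > 0" for n
    proof -
      interpret n: prob_space "nu_measure \<beta> n" using circle_probD(1)[OF circle_prob_nu_measure[OF \<beta> n]] .
      have "z \<in> S" if "z ^ n = 1" for z using n that by (auto simp: S_def)
      then have "measure (nu_measure \<beta> n) S = measure (nu_measure \<beta> n) unit_circle"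
        using measure_nu_measure[OF \<beta> n Scb] measure_nu_measure[OF \<beta> n, of unit_circle]
          sets.top[of circle_borel] Ssub
        by (auto intro!: arg_cong2[where f = "(*)"] sum.cong)
      then show ?thesis using n.prob_space by simp
    qed
    moreover have S': "S \<in> sets \<rho>" using Scb circle_probD(2)[OF \<rho>] by simp
    ultimately have "(c has_sum measure \<rho> S) {0<..}"
      using series unfolding is_convex_series_def
      by (auto elim!: ballE[of _ _ S] intro: has_sum_cong[THEN iffD1, rotated])
    then have "\<rho>.prob S = 1" using c1 has_sum_unique by blast
    then have "AE z in \<rho>. z \<in> S" using S' by (simp add: \<rho>.prob_eq_1)
    then show ?thesis unfolding atomic_measure_def using S by blast
  qed
  moreover have "subconformal \<beta> \<rho>"
    unfolding subconformal_iff
  proof (intro allI impI)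
    fix f :: "complex \<Rightarrow> real" and m :: nat
    assume m: "m > 0" and f: "continuous_on unit_circle f" "\<forall>z\<in>unit_circle. f z \<ge> 0"
    have "compact (f ` unit_circle)" using f(1) by (intro compact_continuous_image) auto
    then obtain B where B: "\<And>z. z \<in> unit_circle \<Longrightarrow> f z \<le> B"
      using compact_imp_bounded bounded_has_Sup(1) by blast
    have "((\<lambda>n. c n * (\<integral>z. f (z ^ d) \<partial>nu_measure \<beta> n)) has_sum (\<integral>z. f (z ^ d) \<partial>\<rho>)) {0<..}" for d
    proof (rule int)
      show "(\<lambda>z. f (z ^ d)) \<in> borel_measurable circle_borel"
        unfolding circle_borel_def
        using continuous_on_circle_power[OF f(1)] by (rule borel_measurable_continuous_on_restrict)
      show "0 \<le> f (z ^ d)" "f (z ^ d) \<le> B" if "z \<in> unit_circle" for z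
        using f(2) B power_in_circle[OF that] by blast+
    qed
    then have "((\<lambda>n. \<Sum>d | d dvd m. of_int (moebius_mu d) * (real d powr (- \<beta>) * (c n * (\<integral>z. f (z ^ d) \<partial>nu_measure \<beta> n))))
        has_sum moebius_sum m (\<lambda>d. real d powr (- \<beta>) * (\<integral>z. f (z ^ d) \<partial>\<rho>))) {0<..}"
      unfolding moebius_sum_def using m by (intro has_sum_sum has_sum_cmult_right) auto
    then show "moebius_sum m (\<lambda>d. real d powr (- \<beta>) * (\<integral>z. f (z ^ d) \<partial>\<rho>)) \<ge> 0"
    proof (rule has_sum_nonneg)
      fix n :: nat assume "n \<in> {0<..}"
      then have n: "n > 0" by simp
      have "moebius_sum m (\<lambda>d. real d powr (- \<beta>) * (\<integral>z. f (z ^ d) \<partial>nu_measure \<beta> n)) \<ge> 0"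
        using subconformal_nu_measure[OF \<beta> n] m f unfolding subconformal_iff by blast
      then have "c n * moebius_sum m (\<lambda>d. real d powr (- \<beta>) * (\<integral>z. f (z ^ d) \<partial>nu_measure \<beta> n)) \<ge> 0"
        using c0[OF n] by simp
      then show "(\<Sum>d | d dvd m. of_int (moebius_mu d) * (real d powr (- \<beta>) * (c n * (\<integral>z. f (z ^ d) \<partial>nu_measure \<beta> n)))) \<ge> 0"
        by (simp add: moebius_sum_def sum_distrib_left mult_ac)
    qed
  qed
  ultimately have "\<rho> \<in> atomic_subconformal_probs \<beta>" using \<rho> by (simp add: atomic_subconformal_probs_def)
  then show ?thesis using that series by blast
qed

lemma has_sum_single:
  fixes f :: "nat \<Rightarrow> real"
  assumes "n \<in> A" "\<And>m. m \<in> A \<Longrightarrow> m \<noteq> n \<Longrightarrow> f m = 0"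
  shows "(f has_sum f n) A"
proof -
  have "(f has_sum f n) {n}" by (rule has_sum_finiteI) auto
  also have "?this \<longleftrightarrow> (f has_sum f n) A" using assms by (intro has_sum_cong_neutral) auto
  finally show ?thesis .
qed

lemma has_sum_remove:
  fixes f :: "nat \<Rightarrow> real"
  assumes "(f has_sum S) A" "n \<in> A"
  shows "((\<lambda>m. if m = n then 0 else f m) has_sum S - f n) A"
proof -
  have "((\<lambda>m. if m = n then f n else 0) has_sum f n) A"
    using has_sum_single[of n A "\<lambda>m. if m = n then f n else 0"] assms(2) by simp
  then have "((\<lambda>m. f m + - (if m = n then f n else 0)) has_sum S + - f n) A"
    by (intro has_sum_add assms(1) has_sum_uminusI)
  also have "?this \<longleftrightarrow> ?thesis" unfolding diff_conv_add_uminus by (intro has_sum_cong) auto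
  finally show ?thesis .
qed

lemma convex_series_single_imp_eq:
  assumes \<beta>: "\<beta> > 0" and \<nu>: "circle_prob \<nu>" and c: "is_convex_series \<nu> (nu_measure \<beta>) c" and n: "n > 0"
    and zero: "\<And>m. m > 0 \<Longrightarrow> m \<noteq> n \<Longrightarrow> c m = 0"
  shows "\<nu> = nu_measure \<beta> n"
proof (rule circle_prob_eqI[OF \<nu> circle_prob_nu_measure[OF \<beta> n]])
  have single: "s = f n" if "(f has_sum s) {0<..}" "\<And>m. m > 0 \<Longrightarrow> m \<noteq> n \<Longrightarrow> f m = 0" for f :: "nat \<Rightarrow> real" and s
  proof (rule has_sum_unique[OF that(1)])
    show "(f has_sum f n) {0<..}" using n that(2) by (intro has_sum_single) auto
  qed
  have "(c has_sum 1) {0<..}" using c unfolding is_convex_series_def by blast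
  then have "1 = c n" using zero by (rule single)
  fix A assume "A \<in> sets (nu_measure \<beta> n)"
  then have "A \<in> sets \<nu>" using circle_probD(2)[OF \<nu>] by simp
  then have "((\<lambda>m. c m * measure (nu_measure \<beta> m) A) has_sum measure \<nu> A) {0<..}"
    using c unfolding is_convex_series_def by blast
  then have "measure \<nu> A = c n * measure (nu_measure \<beta> n) A" by (rule single) (simp add: zero)
  then show "measure \<nu> A = measure (nu_measure \<beta> n) A" using \<open>1 = c n\<close> by simp
qed

lemma convex_series_unique:
  assumes \<beta>: "\<beta> > 0" and \<nu>: "circle_prob \<nu>"
    and c: "is_convex_series \<nu> (nu_measure \<beta>) c" and c': "is_convex_series \<nu> (nu_measure \<beta>) c'"
    and n: "n > 0"
  shows "c n = c' n"
proof -
  have "real n powr (- \<beta>) * c n = real n powr (- \<beta>) * c' n"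
    by (rule has_sum_unique[OF convex_series_coefficient[OF \<beta> \<nu> c n] convex_series_coefficient[OF \<beta> \<nu> c' n]])
  then show ?thesis using n by simp
qed

lemma convex_series_nu_measure:
  assumes \<beta>: "\<beta> > 0" and n: "n > 0"
  shows "is_convex_series (nu_measure \<beta> n) (nu_measure \<beta>) (\<lambda>m. if m = n then 1 else 0)"
proof -
  have *: "((\<lambda>m. (if m = n then 1 else 0) * f m) has_sum f n) {0<..}" for f :: "nat \<Rightarrow> real"
    using has_sum_single[of n "{0<..}" "\<lambda>m. (if m = n then 1 else 0) * f m"] n by simp
  show ?thesis unfolding is_convex_series_def using *[of "\<lambda>_. 1"] * by auto
qed

text \<open>If \<open>nu_measure \<beta> n\<close> is a proper convex combination of two measures, the expansions of these combine to one of
\<open>nu_measure \<beta> n\<close>. By uniqueness all coefficients at \<open>m \<noteq> n\<close> vanish in the combination, and, being non-negative, in both parts.\<close>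
lemma extremal_nu_measure:
  assumes \<beta>: "0 < \<beta>" "\<beta> \<le> 1" and n: "n > 0"
  shows "nu_measure \<beta> n \<in> extremal_measures (atomic_subconformal_probs \<beta>)"
  unfolding extremal_measures_def mem_Collect_eq
proof (intro conjI ballI allI impI nu_measure_in_atomic_subconformal[OF \<beta>(1) n])
  have circ: "circle_prob (nu_measure \<beta> n)" by (rule circle_prob_nu_measure[OF \<beta>(1) n])
  have main: "\<nu>1 = nu_measure \<beta> n"
    if \<nu>1: "\<nu>1 \<in> atomic_subconformal_probs \<beta>" and \<nu>2: "\<nu>2 \<in> atomic_subconformal_probs \<beta>"
      and t: "0 < t" "t < 1"
      and eq: "\<And>A. A \<in> sets (nu_measure \<beta> n) \<Longrightarrow> measure (nu_measure \<beta> n) A = t * measure \<nu>1 A + (1 - t) * measure \<nu>2 A"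
    for \<nu>1 \<nu>2 t
  proof -
    interpret 1: atomic_subconformal_prob \<beta> \<nu>1 using \<beta> \<nu>1 by unfold_locales
    interpret 2: atomic_subconformal_prob \<beta> \<nu>2 using \<beta> \<nu>2 by unfold_locales
    obtain c1 where c1: "is_convex_series \<nu>1 (nu_measure \<beta>) c1" using "1.convex_series_series_weight" by blast
    obtain c2 where c2: "is_convex_series \<nu>2 (nu_measure \<beta>) c2" using "2.convex_series_series_weight" by blast
    have sets: "sets \<nu>1 = sets circle_borel" "sets \<nu>2 = sets circle_borel"
      using circle_probD(2) "1.circle" "2.circle" by blast+
    have "is_convex_series (nu_measure \<beta> n) (nu_measure \<beta>) (\<lambda>m. t * c1 m + (1 - t) * c2 m)"
      unfolding is_convex_series_def
    proof (intro conjI allI impI ballI)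
      fix m :: nat assume "m > 0"
      then show "t * c1 m + (1 - t) * c2 m \<ge> 0" using c1 c2 t by (simp add: is_convex_series_def)
    next
      have "((\<lambda>m. t * c1 m + (1 - t) * c2 m) has_sum t * 1 + (1 - t) * 1) {0<..}"
        using c1 c2 unfolding is_convex_series_def by (intro has_sum_add has_sum_cmult_right) auto
      then show "((\<lambda>m. t * c1 m + (1 - t) * c2 m) has_sum 1) {0<..}" by simp
    next
      fix A assume A: "A \<in> sets (nu_measure \<beta> n)"
      then have "A \<in> sets \<nu>1" "A \<in> sets \<nu>2" using sets by auto
      then have "((\<lambda>m. t * (c1 m * measure (nu_measure \<beta> m) A) + (1 - t) * (c2 m * measure (nu_measure \<beta> m) A))
          has_sum t * measure \<nu>1 A + (1 - t) * measure \<nu>2 A) {0<..}"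
        using c1 c2 unfolding is_convex_series_def by (intro has_sum_add has_sum_cmult_right) auto
      then show "((\<lambda>m. (t * c1 m + (1 - t) * c2 m) * measure (nu_measure \<beta> m) A) has_sum measure (nu_measure \<beta> n) A) {0<..}"
        unfolding eq[OF A] by (simp add: algebra_simps)
    qed
    from convex_series_unique[OF \<beta>(1) circ this convex_series_nu_measure[OF \<beta>(1) n]]
    have "t * c1 m + (1 - t) * c2 m = 0" if "m > 0" "m \<noteq> n" for m using that by simp
    moreover have "c1 m \<ge> 0" "c2 m \<ge> 0" if "m > 0" for m
      using c1 c2 that by (auto simp: is_convex_series_def)
    ultimately have "c1 m = 0" if "m > 0" "m \<noteq> n" for m
      using that t by (smt (verit) mult_nonneg_nonneg mult_pos_pos)
    then show ?thesis using convex_series_single_imp_eq[OF \<beta>(1) "1.circle" c1 n] by blast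
  qed
  fix \<nu>1 \<nu>2 t
  assume K: "\<nu>1 \<in> atomic_subconformal_probs \<beta>" "\<nu>2 \<in> atomic_subconformal_probs \<beta>"
    and t: "0 < t \<and> t < 1 \<and> (\<forall>A\<in>sets (nu_measure \<beta> n). measure (nu_measure \<beta> n) A = t * measure \<nu>1 A + (1 - t) * measure \<nu>2 A)"
  show "\<nu>1 = nu_measure \<beta> n" using t by (intro main[OF K, of t]) auto
  show "\<nu>2 = nu_measure \<beta> n" using t by (intro main[OF K(2,1), of "1 - t"]) auto
qed

text \<open>If \<open>n\<close> has a coefficient \<open>c n\<close> strictly between \<open>0\<close> and \<open>1\<close>, then \<open>\<nu>\<close> is a proper convex combination of \<open>nu_measure \<beta> n\<close> and the
normalised mixture of the other terms, so extremality identifies it with the former.\<close>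
lemma extremal_imp_nu_measure:
  assumes \<beta>: "0 < \<beta>" "\<beta> \<le> 1" and \<nu>: "\<nu> \<in> extremal_measures (atomic_subconformal_probs \<beta>)"
  shows "\<exists>n>0. \<nu> = nu_measure \<beta> n"
proof -
  have \<nu>K: "\<nu> \<in> atomic_subconformal_probs \<beta>" using \<nu> by (simp add: extremal_measures_def)
  interpret atomic_subconformal_prob \<beta> \<nu> using \<beta> \<nu>K by unfold_locales
  obtain c where c: "is_convex_series \<nu> (nu_measure \<beta>) c" using convex_series_series_weight by blast
  have c0: "\<And>m. m > 0 \<Longrightarrow> c m \<ge> 0" and c1: "(c has_sum 1) {0<..}"
    using c by (auto simp: is_convex_series_def)
  have "\<exists>n>0. c n > 0"
  proof (rule ccontr)
    assume "\<not> (\<exists>n>0. c n > 0)"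
    then have "c m = 0" if "m > 0" for m using c0[OF that] that by (meson antisym not_le)
    moreover from this have "(c has_sum c 1) {0<..}" by (intro has_sum_single) auto
    ultimately show False using has_sum_unique[OF c1] by fastforce
  qed
  then obtain n where n: "n > 0" "c n > 0" by blast
  \<comment> \<open>The coefficients of the remainder after splitting off the n-th term.\<close>
  define r where "r m = (if m = n then 0 else c m)" for m
  have r: "(r has_sum 1 - c n) {0<..}" unfolding r_def using n by (intro has_sum_remove[OF c1]) simp
  have r0: "r m \<ge> 0" if "m > 0" for m using c0[OF that] by (simp add: r_def)
  have "\<nu> = nu_measure \<beta> n"
  proof (cases "c n = 1")
    case True
    then have "(r has_sum 0) {0<..}" using r by simp
    then have "r m = 0" if "m > 0" for m
      using nonneg_has_sum_le_0D[of r "{0<..}" 0 m] r0 that by auto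
    then have "c m = 0" if "m > 0" "m \<noteq> n" for m using that by (metis r_def)
    then show ?thesis using convex_series_single_imp_eq[OF \<beta>(1) circle c n(1)] by blast
  next
    case False
    have "1 - c n \<ge> 0" using r r0 by (intro has_sum_nonneg[OF r]) auto
    then have cn: "c n < 1" using False by simp
    have "((\<lambda>m. 1 / (1 - c n) * r m) has_sum 1 / (1 - c n) * (1 - c n)) {0<..}"
      using r by (rule has_sum_cmult_right)
    then have sum: "((\<lambda>m. 1 / (1 - c n) * r m) has_sum 1) {0<..}" using cn by simp
    obtain \<rho> where \<rho>: "\<rho> \<in> atomic_subconformal_probs \<beta>"
      "is_convex_series \<rho> (nu_measure \<beta>) (\<lambda>m. 1 / (1 - c n) * r m)"
      using nu_mixture[OF \<beta>(1) _ sum] r0 cn by auto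
    have "measure \<nu> A = c n * measure (nu_measure \<beta> n) A + (1 - c n) * measure \<rho> A" if A: "A \<in> sets \<nu>" for A
    proof -
      have A': "A \<in> sets \<rho>" using A \<rho>(1) circle_probD(2) circle by (auto simp: atomic_subconformal_probs_def)
      have "((\<lambda>m. (1 - c n) * (1 / (1 - c n) * r m * measure (nu_measure \<beta> m) A)) has_sum (1 - c n) * measure \<rho> A) {0<..}"
        using \<rho>(2) A' unfolding is_convex_series_def by (intro has_sum_cmult_right) blast
      then have 1: "((\<lambda>m. r m * measure (nu_measure \<beta> m) A) has_sum (1 - c n) * measure \<rho> A) {0<..}"
        using cn by simp
      have "((\<lambda>m. if m = n then 0 else c m * measure (nu_measure \<beta> m) A) has_sum
          measure \<nu> A - c n * measure (nu_measure \<beta> n) A) {0<..}"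
        using c A n unfolding is_convex_series_def by (intro has_sum_remove) auto
      also have "?this \<longleftrightarrow> ((\<lambda>m. r m * measure (nu_measure \<beta> m) A) has_sum
          measure \<nu> A - c n * measure (nu_measure \<beta> n) A) {0<..}"
        by (intro has_sum_cong) (auto simp: r_def)
      finally show ?thesis using has_sum_unique[OF 1] by fastforce
    qed
    then show ?thesis
      using \<nu> nu_measure_in_atomic_subconformal[OF \<beta>(1) n(1)] \<rho>(1) n cn
      unfolding extremal_measures_def by blast
  qed
  then show ?thesis using n by blast
qed

theorem theorem5p9:
  fixes \<beta> :: real
  assumes "0 < \<beta>" and "\<beta> \<le> 1"
  shows "(\<forall>\<nu>\<in>atomic_subconformal_probs \<beta>. \<exists>l.
            is_convex_series \<nu> (nu_measure \<beta>) l \<and>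
            (\<forall>c. is_convex_series \<nu> (nu_measure \<beta>) c \<longrightarrow> (\<forall>n>0. c n = l n)) \<and>
            (\<forall>n>0.
               (\<lambda>d. of_int (moebius_mu d) * (1 / totient_powr \<beta> (n * d)) *
                     measure \<nu> (primitive_roots (n * d))) summable_on {0<..} \<and>
               l n = real n powr \<beta> *
                 (\<Sum>\<^sub>\<infinity>d\<in>{0<..}. of_int (moebius_mu d) * (1 / totient_powr \<beta> (n * d)) *
                     measure \<nu> (primitive_roots (n * d)))))
       \<and> extremal_measures (atomic_subconformal_probs \<beta>) = {nu_measure \<beta> n | n. n > 0}"
proof (intro conjI ballI)
  fix \<nu> assume "\<nu> \<in> atomic_subconformal_probs \<beta>"
  then interpret atomic_subconformal_prob \<beta> \<nu> using assms by unfold_locales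
  let ?l = "\<lambda>n. real n powr \<beta> * series_weight n"
  have summand_eq: "of_int (moebius_mu d) * (1 / totient_powr \<beta> (n * d)) * measure \<nu> (primitive_roots (n * d)) =
      of_int (moebius_mu d) * scaled_mass (n * d)" for n d
    by (simp add: scaled_mass_def order_mass_def)
  have "\<forall>c. is_convex_series \<nu> (nu_measure \<beta>) c \<longrightarrow> (\<forall>n>0. c n = ?l n)"
    using convex_series_unique[OF assms(1) circle _ convex_series_series_weight] by blast
  moreover have "\<forall>n>0.
      (\<lambda>d. of_int (moebius_mu d) * (1 / totient_powr \<beta> (n * d)) * measure \<nu> (primitive_roots (n * d))) summable_on {0<..} \<and>
      ?l n = real n powr \<beta> * (\<Sum>\<^sub>\<infinity>d\<in>{0<..}. of_int (moebius_mu d) * (1 / totient_powr \<beta> (n * d)) *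
        measure \<nu> (primitive_roots (n * d)))"
    unfolding summand_eq series_weight_def using moebius_scaled_mass_summable by blast
  ultimately show "\<exists>l. is_convex_series \<nu> (nu_measure \<beta>) l \<and>
      (\<forall>c. is_convex_series \<nu> (nu_measure \<beta>) c \<longrightarrow> (\<forall>n>0. c n = l n)) \<and>
      (\<forall>n>0.
         (\<lambda>d. of_int (moebius_mu d) * (1 / totient_powr \<beta> (n * d)) *
               measure \<nu> (primitive_roots (n * d))) summable_on {0<..} \<and>
         l n = real n powr \<beta> *
           (\<Sum>\<^sub>\<infinity>d\<in>{0<..}. of_int (moebius_mu d) * (1 / totient_powr \<beta> (n * d)) *
               measure \<nu> (primitive_roots (n * d))))"
    using convex_series_series_weight by (intro exI[of _ ?l] conjI)
next
  show "extremal_measures (atomic_subconformal_probs \<beta>) = {nu_measure \<beta> n | n. n > 0}"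
    using extremal_nu_measure[OF assms] extremal_imp_nu_measure[OF assms] by blast
qed

end
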